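(* Let $\Gamma$ be a finite abelian group, let $\mathcal C$ be a $\Bbbk$-linear abelian monoidal category with simple monoidal unit, and let $A=\bigoplus_{i\in\Gamma}A_i$ be a $\Gamma$-graded twisted group algebra in $\mathcal C$. For $x\in\mathcal C$ write $\mathrm{Ind}(x)=(x\otimes A,\mathrm{id}_x\otimes\mu)$ for the induced right $A$-module. (i) The space $\mathrm{Hom}_A(\mathrm{Ind}(x),\mathrm{Ind}(y))$ of module morphisms between any two simple induced $A$-modules $\mathrm{Ind}(x)$ and $\mathrm{Ind}(y)$ is either zero or isomorphic as a $\Gamma$-graded $\Bbbk$-vector space to the spaces of endomorphisms of both $\mathrm{Ind}(x)$ and $\mathrm{Ind}(y)$. (ii) Any non-zero homogeneous module morphism between simple induced $A$-modules is an isomorphism.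
   Context: $\Bbbk$ is an algebraically closed field whose characteristic is coprime to $|\Gamma|$ ($\Gamma$ is written additively). All categories are additive and $\Bbbk$-linear; associators and unitors are suppressed; $\mathrm{Hom}(\mathbf 1,\mathbf 1)\cong\Bbbk$. Algebra: an object $A$ with associative multiplication $\mu:A\otimes A\to A$ and unit $\eta:\mathbf 1\to A$. A $\Gamma$-graded algebra is one with a decomposition $A=\bigoplus_{i\in\Gamma}A_i$ such that $\mu$ maps $A_i\otimes A_j$ to $A_{i+j}$; the component is written $\mu_{i,j}:A_i\otimes A_j\to A_{i+j}$. Twisted group algebra: let $\mathrm{Pic}(\mathcal C)$ be the group of isomorphism classes of invertible objects of $\mathcal C$ and $\Gamma\le\mathrm{Pic}(\mathcal C)$ a finite (here abelian) subgroup. Let $L_i$ ($i\in\Gamma$) be invertible objects with $L_0\cong\mathbf 1$, $L_{i+j}\cong L_i\otimes L_j$, and $L_i\not\cong L_j$ for $i\ne j$. Choose bases $\lambda_{i,j}$ of the one-dimensional spaces $\mathrm{Hom}(L_i\otimes L_j,L_{i+j})$ and let $\psi(i,j,k)\in\Bbbk^\times$ be the three-cocycle describing the associator, i.e. $\lambda_{i+j,k}\circ(\lambda_{i,j}\otimes\mathrm{id})=\psi(i,j,k)^{-1}\,\lambda_{i,j+k}\circ(\mathrm{id}\otimes\lambda_{j,k})$ (with the associator suppressed on the right hand side). Let $\omega:\Gamma\times\Gamma\to\Bbbk^\times$ satisfy $\omega(i,j)\,\omega(i+j,k)=\omega(j,k)\,\omega(i,j+k)\,\psi(i,j,k)$.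 The twisted group algebra is $A=\bigoplus_{i\in\Gamma}L_i$ (so $A_i=L_i$) with $\mu_{i,j}=\omega(i,j)\,\lambda_{i,j}$ and with unit given by the embedding of $L_0\cong\mathbf 1$. Induced modules: $\mathrm{ind}\text{-}A$ is the full subcategory of the category of right $A$-modules on the modules $\mathrm{Ind}(x)=(x\otimes A,\mathrm{id}_x\otimes\mu)$, $x\in\mathcal C$. An object of $\mathrm{ind}\text{-}A$ is called a simple induced $A$-module iff it has precisely two quotient objects in $\mathrm{ind}\text{-}A$, itself and zero. Grading: $\mathrm{Ind}(x)$ is $\Gamma$-graded with components $x\otimes A_i$; a module morphism $f:\mathrm{Ind}(x)\to\mathrm{Ind}(y)$ is homogeneous of grade $i$ iff it maps $x\otimes A_j$ into $y\otimes A_{i+j}$ for all $j$. In this way the morphism spaces of $\mathrm{ind}\text{-}A$ are $\Gamma$-graded vector spaces.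
   Formalization: In (i), the isomorphism of Γ-graded vector spaces is homogeneous of some degree d, the same d for both endomorphism spaces, not necessarily degree-preserving; the degree-preserving claim fails for Γ-graded vector spaces, A the group algebra, x = 1, y = L_k with k ≠ 0. *)

theory Defs
  imports "HOL-Computational_Algebra.Computational_Algebra"
begin

section \<open>Categories\<close>

text \<open>
  Morphisms live in a single type \<open>'m\<close>; \<open>Hom C x y\<close> is the set of morphisms from \<open>x\<close> to \<open>y\<close>.
  Hom-sets of different pairs of objects need not be disjoint, so every notion about a morphism
  carries its source and target explicitly. \<open>g \<cdot> f\<close> is the composite ``first \<open>f\<close>, then \<open>g\<close>''.
\<close>

record ('o, 'm) category =
  Obj :: "'o set"
  Hom :: "'o \<Rightarrow> 'o \<Rightarrow> 'm set"
  Comp :: "'m \<Rightarrow> 'm \<Rightarrow> 'm"  (infixr \<open>\<cdot>\<index>\<close> 70)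
  Ident :: "'o \<Rightarrow> 'm"

definition is_mono :: "('o, 'm, 'z) category_scheme \<Rightarrow> 'o \<Rightarrow> 'o \<Rightarrow> 'm \<Rightarrow> bool" where
  "is_mono C x y f \<longleftrightarrow> x \<in> Obj C \<and> y \<in> Obj C \<and> f \<in> Hom C x y \<and>
     (\<forall>w\<in>Obj C. \<forall>g\<in>Hom C w x. \<forall>h\<in>Hom C w x. f \<cdot>\<^bsub>C\<^esub> g = f \<cdot>\<^bsub>C\<^esub> h \<longrightarrow> g = h)"

definition is_epi :: "('o, 'm, 'z) category_scheme \<Rightarrow> 'o \<Rightarrow> 'o \<Rightarrow> 'm \<Rightarrow> bool" where
  "is_epi C x y f \<longleftrightarrow> x \<in> Obj C \<and> y \<in> Obj C \<and> f \<in> Hom C x y \<and>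
     (\<forall>z\<in>Obj C. \<forall>g\<in>Hom C y z. \<forall>h\<in>Hom C y z. g \<cdot>\<^bsub>C\<^esub> f = h \<cdot>\<^bsub>C\<^esub> f \<longrightarrow> g = h)"

definition is_iso :: "('o, 'm, 'z) category_scheme \<Rightarrow> 'o \<Rightarrow> 'o \<Rightarrow> 'm \<Rightarrow> bool" where
  "is_iso C x y f \<longleftrightarrow> x \<in> Obj C \<and> y \<in> Obj C \<and> f \<in> Hom C x y \<and>
     (\<exists>g\<in>Hom C y x. g \<cdot>\<^bsub>C\<^esub> f = Ident C x \<and> f \<cdot>\<^bsub>C\<^esub> g = Ident C y)"

definition isomorphic :: "('o, 'm, 'z) category_scheme \<Rightarrow> 'o \<Rightarrow> 'o \<Rightarrow> bool" where
  "isomorphic C x y \<longleftrightarrow> (\<exists>f. is_iso C x y f)"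

definition zero_object :: "('o, 'm, 'z) category_scheme \<Rightarrow> 'o \<Rightarrow> bool" where
  "zero_object C z \<longleftrightarrow> z \<in> Obj C \<and>
     (\<forall>x\<in>Obj C. (\<exists>!f. f \<in> Hom C z x) \<and> (\<exists>!f. f \<in> Hom C x z))"

definition full_subcategory :: "('o, 'm, 'z) category_scheme \<Rightarrow> 'o set \<Rightarrow> ('o, 'm) category" where
  "full_subcategory C S = \<lparr>Obj = S, Hom = Hom C, Comp = Comp C, Ident = Ident C\<rparr>"

definition simple_object :: "('o, 'm, 'z) category_scheme \<Rightarrow> 'o \<Rightarrow> bool" where
  "simple_object C x \<longleftrightarrow> x \<in> Obj C \<and> \<not> zero_object C x \<and>
     (\<forall>y m. is_mono C y x m \<longrightarrow> zero_object C y \<or> is_iso C y x m)"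


subsection \<open>Quotient objects\<close>

text \<open>
  A quotient object of \<open>x\<close> is an equivalence class of epimorphisms out of \<open>x\<close>, two of them being
  equivalent iff they differ by an isomorphism of their targets.
\<close>

definition epis_from :: "('o, 'm, 'z) category_scheme \<Rightarrow> 'o \<Rightarrow> ('o \<times> 'm) set" where
  "epis_from C x = {(y, e). is_epi C x y e}"

definition quotient_rel ::
    "('o, 'm, 'z) category_scheme \<Rightarrow> 'o \<Rightarrow> (('o \<times> 'm) \<times> ('o \<times> 'm)) set" where
  "quotient_rel C x = {((y, e), (y', e')). (y, e) \<in> epis_from C x \<and> (y', e') \<in> epis_from C x \<and>
     (\<exists>h. is_iso C y y' h \<and> h \<cdot>\<^bsub>C\<^esub> e = e')}"

definition quotient_objects :: "('o, 'm, 'z) category_scheme \<Rightarrow> 'o \<Rightarrow> ('o \<times> 'm) set set" where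
  "quotient_objects C x = epis_from C x // quotient_rel C x"

definition quotient_class ::
    "('o, 'm, 'z) category_scheme \<Rightarrow> 'o \<Rightarrow> 'o \<times> 'm \<Rightarrow> ('o \<times> 'm) set" where
  "quotient_class C x p = quotient_rel C x `` {p}"

text \<open>Precisely two quotient objects: \<open>x\<close> itself and zero.\<close>

definition quotient_simple :: "('o, 'm::zero, 'z) category_scheme \<Rightarrow> 'o \<Rightarrow> bool" where
  "quotient_simple C x \<longleftrightarrow> x \<in> Obj C \<and>
     (\<exists>z. zero_object C z \<and>
          quotient_class C x (x, Ident C x) \<noteq> quotient_class C x (z, 0) \<and>
          quotient_objects C x =
            {quotient_class C x (x, Ident C x), quotient_class C x (z, 0)})"


section \<open>Linear and abelian categories\<close>

text \<open>
  The hom-spaces of a linear category are subspaces of one ambient vector space \<open>'m\<close>, so that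
  addition and zero need not be indexed by objects. This is no restriction: the direct sum of all
  hom-spaces is such an ambient space, and composition (and a bilinear tensor product) extends to
  it bilinearly.
\<close>

locale linear_category = vector_space scale
  for scale :: "'k::field \<Rightarrow> 'm::ab_group_add \<Rightarrow> 'm"  (infixr \<open>*s\<close> 75) +
  fixes C :: "('o, 'm, 'z) category_scheme"  (structure)
  assumes hom_subspace: "\<lbrakk>x \<in> Obj C; y \<in> Obj C\<rbrakk> \<Longrightarrow> subspace (Hom C x y)"
    and ident_hom: "x \<in> Obj C \<Longrightarrow> Ident C x \<in> Hom C x x"
    and comp_hom: "\<lbrakk>x \<in> Obj C; y \<in> Obj C; z \<in> Obj C; f \<in> Hom C x y; g \<in> Hom C y z\<rbrakk>
      \<Longrightarrow> g \<cdot> f \<in> Hom C x z"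
    and comp_ident_right: "\<lbrakk>x \<in> Obj C; y \<in> Obj C; f \<in> Hom C x y\<rbrakk> \<Longrightarrow> f \<cdot> Ident C x = f"
    and comp_ident_left: "\<lbrakk>x \<in> Obj C; y \<in> Obj C; f \<in> Hom C x y\<rbrakk> \<Longrightarrow> Ident C y \<cdot> f = f"
    and comp_assoc: "\<lbrakk>w \<in> Obj C; x \<in> Obj C; y \<in> Obj C; z \<in> Obj C;
        f \<in> Hom C w x; g \<in> Hom C x y; h \<in> Hom C y z\<rbrakk> \<Longrightarrow> (h \<cdot> g) \<cdot> f = h \<cdot> (g \<cdot> f)"
    and comp_add_right: "\<lbrakk>x \<in> Obj C; y \<in> Obj C; z \<in> Obj C;
        f \<in> Hom C x y; f' \<in> Hom C x y; g \<in> Hom C y z\<rbrakk> \<Longrightarrow> g \<cdot> (f + f') = g \<cdot> f + g \<cdot> f'"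
    and comp_add_left: "\<lbrakk>x \<in> Obj C; y \<in> Obj C; z \<in> Obj C;
        f \<in> Hom C x y; g \<in> Hom C y z; g' \<in> Hom C y z\<rbrakk> \<Longrightarrow> (g + g') \<cdot> f = g \<cdot> f + g' \<cdot> f"
    and comp_scale_right: "\<lbrakk>x \<in> Obj C; y \<in> Obj C; z \<in> Obj C; f \<in> Hom C x y; g \<in> Hom C y z\<rbrakk>
      \<Longrightarrow> g \<cdot> (c *s f) = c *s (g \<cdot> f)"
    and comp_scale_left: "\<lbrakk>x \<in> Obj C; y \<in> Obj C; z \<in> Obj C; f \<in> Hom C x y; g \<in> Hom C y z\<rbrakk>
      \<Longrightarrow> (c *s g) \<cdot> f = c *s (g \<cdot> f)"

definition is_biproduct ::
    "('o, 'm::ab_group_add, 'z) category_scheme \<Rightarrow> 'i set \<Rightarrow> ('i \<Rightarrow> 'o) \<Rightarrow> 'o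
      \<Rightarrow> ('i \<Rightarrow> 'm) \<Rightarrow> ('i \<Rightarrow> 'm) \<Rightarrow> bool" where
  "is_biproduct C I X P emb prj \<longleftrightarrow> finite I \<and> P \<in> Obj C \<and> (\<forall>i\<in>I. X i \<in> Obj C) \<and>
     (\<forall>i\<in>I. emb i \<in> Hom C (X i) P \<and> prj i \<in> Hom C P (X i)) \<and>
     (\<forall>i\<in>I. \<forall>j\<in>I. prj i \<cdot>\<^bsub>C\<^esub> emb j = (if i = j then Ident C (X i) else 0)) \<and>
     (\<Sum>i\<in>I. emb i \<cdot>\<^bsub>C\<^esub> prj i) = Ident C P"

definition is_kernel ::
    "('o, 'm::zero, 'z) category_scheme \<Rightarrow> 'o \<Rightarrow> 'o \<Rightarrow> 'm \<Rightarrow> 'o \<Rightarrow> 'm \<Rightarrow> bool" where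
  "is_kernel C x y f k m \<longleftrightarrow> k \<in> Obj C \<and> m \<in> Hom C k x \<and> f \<cdot>\<^bsub>C\<^esub> m = 0 \<and>
     (\<forall>w\<in>Obj C. \<forall>g\<in>Hom C w x. f \<cdot>\<^bsub>C\<^esub> g = 0 \<longrightarrow> (\<exists>!h. h \<in> Hom C w k \<and> m \<cdot>\<^bsub>C\<^esub> h = g))"

definition is_cokernel ::
    "('o, 'm::zero, 'z) category_scheme \<Rightarrow> 'o \<Rightarrow> 'o \<Rightarrow> 'm \<Rightarrow> 'o \<Rightarrow> 'm \<Rightarrow> bool" where
  "is_cokernel C x y f c e \<longleftrightarrow> c \<in> Obj C \<and> e \<in> Hom C y c \<and> e \<cdot>\<^bsub>C\<^esub> f = 0 \<and>
     (\<forall>z\<in>Obj C. \<forall>g\<in>Hom C y z. g \<cdot>\<^bsub>C\<^esub> f = 0 \<longrightarrow> (\<exists>!h. h \<in> Hom C c z \<and> h \<cdot>\<^bsub>C\<^esub> e = g))"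

locale abelian_category = linear_category scale C
  for scale :: "'k::field \<Rightarrow> 'm::ab_group_add \<Rightarrow> 'm"
    and C :: "('o, 'm, 'z) category_scheme"  (structure) +
  assumes ex_zero_object: "\<exists>z. zero_object C z"
    and ex_biproduct: "\<lbrakk>x \<in> Obj C; y \<in> Obj C\<rbrakk>
      \<Longrightarrow> \<exists>P emb prj. is_biproduct C (UNIV :: bool set) (\<lambda>b. if b then x else y) P emb prj"
    and ex_kernel: "\<lbrakk>x \<in> Obj C; y \<in> Obj C; f \<in> Hom C x y\<rbrakk> \<Longrightarrow> \<exists>k m. is_kernel C x y f k m"
    and ex_cokernel: "\<lbrakk>x \<in> Obj C; y \<in> Obj C; f \<in> Hom C x y\<rbrakk> \<Longrightarrow> \<exists>c e. is_cokernel C x y f c e"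
    and mono_normal: "is_mono C x y f \<Longrightarrow> \<exists>z\<in>Obj C. \<exists>g\<in>Hom C y z. is_kernel C y z g x f"
    and epi_normal: "is_epi C x y f \<Longrightarrow> \<exists>w\<in>Obj C. \<exists>g\<in>Hom C w x. is_cokernel C w x g y f"


section \<open>Monoidal categories\<close>

text \<open>\<open>x \<otimes> y\<close> is the tensor product of objects, \<open>f \<boxtimes> g\<close> that of morphisms.\<close>

record ('o, 'm) monoidal_category = "('o, 'm) category" +
  Tens :: "'o \<Rightarrow> 'o \<Rightarrow> 'o"  (infixr \<open>\<otimes>\<index>\<close> 75)
  TensM :: "'m \<Rightarrow> 'm \<Rightarrow> 'm"  (infixr \<open>\<boxtimes>\<index>\<close> 75)
  Unit :: 'o  (\<open>\<one>\<index>\<close>)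
  Assoc :: "'o \<Rightarrow> 'o \<Rightarrow> 'o \<Rightarrow> 'm"
  LUnit :: "'o \<Rightarrow> 'm"
  RUnit :: "'o \<Rightarrow> 'm"

text \<open>The tensor product is only required to be bilinear on morphisms, not to be exact.\<close>

locale abelian_monoidal_category = abelian_category scale C
  for scale :: "'k::field \<Rightarrow> 'm::ab_group_add \<Rightarrow> 'm"  (infixr \<open>*s\<close> 75)
    and C :: "('o, 'm, 'z) monoidal_category_scheme"  (structure) +
  assumes unit_obj: "\<one> \<in> Obj C"
    and tens_obj: "\<lbrakk>x \<in> Obj C; y \<in> Obj C\<rbrakk> \<Longrightarrow> x \<otimes> y \<in> Obj C"
    and tens_hom: "\<lbrakk>x \<in> Obj C; y \<in> Obj C; x' \<in> Obj C; y' \<in> Obj C;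
        f \<in> Hom C x y; f' \<in> Hom C x' y'\<rbrakk> \<Longrightarrow> f \<boxtimes> f' \<in> Hom C (x \<otimes> x') (y \<otimes> y')"
    and tens_ident: "\<lbrakk>x \<in> Obj C; y \<in> Obj C\<rbrakk> \<Longrightarrow> Ident C x \<boxtimes> Ident C y = Ident C (x \<otimes> y)"
    and tens_comp: "\<lbrakk>x \<in> Obj C; y \<in> Obj C; z \<in> Obj C; x' \<in> Obj C; y' \<in> Obj C; z' \<in> Obj C;
        f \<in> Hom C x y; g \<in> Hom C y z; f' \<in> Hom C x' y'; g' \<in> Hom C y' z'\<rbrakk>
      \<Longrightarrow> (g \<cdot> f) \<boxtimes> (g' \<cdot> f') = (g \<boxtimes> g') \<cdot> (f \<boxtimes> f')"
    and tens_add_left: "\<lbrakk>x \<in> Obj C; y \<in> Obj C; x' \<in> Obj C; y' \<in> Obj C;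
        f \<in> Hom C x y; g \<in> Hom C x y; f' \<in> Hom C x' y'\<rbrakk>
      \<Longrightarrow> (f + g) \<boxtimes> f' = f \<boxtimes> f' + g \<boxtimes> f'"
    and tens_add_right: "\<lbrakk>x \<in> Obj C; y \<in> Obj C; x' \<in> Obj C; y' \<in> Obj C;
        f \<in> Hom C x y; f' \<in> Hom C x' y'; g' \<in> Hom C x' y'\<rbrakk>
      \<Longrightarrow> f \<boxtimes> (f' + g') = f \<boxtimes> f' + f \<boxtimes> g'"
    and tens_scale_left: "\<lbrakk>x \<in> Obj C; y \<in> Obj C; x' \<in> Obj C; y' \<in> Obj C;
        f \<in> Hom C x y; f' \<in> Hom C x' y'\<rbrakk> \<Longrightarrow> (c *s f) \<boxtimes> f' = c *s (f \<boxtimes> f')"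
    and tens_scale_right: "\<lbrakk>x \<in> Obj C; y \<in> Obj C; x' \<in> Obj C; y' \<in> Obj C;
        f \<in> Hom C x y; f' \<in> Hom C x' y'\<rbrakk> \<Longrightarrow> f \<boxtimes> (c *s f') = c *s (f \<boxtimes> f')"
    and assoc_iso: "\<lbrakk>x \<in> Obj C; y \<in> Obj C; z \<in> Obj C\<rbrakk>
      \<Longrightarrow> is_iso C ((x \<otimes> y) \<otimes> z) (x \<otimes> (y \<otimes> z)) (Assoc C x y z)"
    and lunit_iso: "x \<in> Obj C \<Longrightarrow> is_iso C (\<one> \<otimes> x) x (LUnit C x)"
    and runit_iso: "x \<in> Obj C \<Longrightarrow> is_iso C (x \<otimes> \<one>) x (RUnit C x)"
    and assoc_natural: "\<lbrakk>x \<in> Obj C; y \<in> Obj C; z \<in> Obj C; x' \<in> Obj C; y' \<in> Obj C; z' \<in> Obj C;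
        f \<in> Hom C x x'; g \<in> Hom C y y'; h \<in> Hom C z z'\<rbrakk>
      \<Longrightarrow> Assoc C x' y' z' \<cdot> ((f \<boxtimes> g) \<boxtimes> h) = (f \<boxtimes> (g \<boxtimes> h)) \<cdot> Assoc C x y z"
    and lunit_natural: "\<lbrakk>x \<in> Obj C; y \<in> Obj C; f \<in> Hom C x y\<rbrakk>
      \<Longrightarrow> LUnit C y \<cdot> (Ident C \<one> \<boxtimes> f) = f \<cdot> LUnit C x"
    and runit_natural: "\<lbrakk>x \<in> Obj C; y \<in> Obj C; f \<in> Hom C x y\<rbrakk>
      \<Longrightarrow> RUnit C y \<cdot> (f \<boxtimes> Ident C \<one>) = f \<cdot> RUnit C x"
    and pentagon: "\<lbrakk>w \<in> Obj C; x \<in> Obj C; y \<in> Obj C; z \<in> Obj C\<rbrakk>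
      \<Longrightarrow> Assoc C w x (y \<otimes> z) \<cdot> Assoc C (w \<otimes> x) y z =
          (Ident C w \<boxtimes> Assoc C x y z) \<cdot> Assoc C w (x \<otimes> y) z \<cdot> (Assoc C w x y \<boxtimes> Ident C z)"
    and triangle: "\<lbrakk>x \<in> Obj C; y \<in> Obj C\<rbrakk>
      \<Longrightarrow> (Ident C x \<boxtimes> LUnit C y) \<cdot> Assoc C x \<one> y = RUnit C x \<boxtimes> Ident C y"

definition invertible_object :: "('o, 'm, 'z) monoidal_category_scheme \<Rightarrow> 'o \<Rightarrow> bool" where
  "invertible_object C x \<longleftrightarrow> x \<in> Obj C \<and>
     (\<exists>y\<in>Obj C. isomorphic C (x \<otimes>\<^bsub>C\<^esub> y) \<one>\<^bsub>C\<^esub> \<and> isomorphic C (y \<otimes>\<^bsub>C\<^esub> x) \<one>\<^bsub>C\<^esub>)"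


section \<open>Algebras and modules\<close>

record ('o, 'm) algebra =
  alg_obj :: 'o
  alg_mult :: 'm
  alg_unit :: 'm

definition is_algebra ::
    "('o, 'm, 'z) monoidal_category_scheme \<Rightarrow> ('o, 'm) algebra \<Rightarrow> bool" where
  "is_algebra C A \<longleftrightarrow>
     (let a = alg_obj A; \<mu> = alg_mult A; \<eta> = alg_unit A in
       a \<in> Obj C \<and> \<mu> \<in> Hom C (a \<otimes>\<^bsub>C\<^esub> a) a \<and> \<eta> \<in> Hom C \<one>\<^bsub>C\<^esub> a \<and>
       \<mu> \<cdot>\<^bsub>C\<^esub> (\<mu> \<boxtimes>\<^bsub>C\<^esub> Ident C a) = \<mu> \<cdot>\<^bsub>C\<^esub> (Ident C a \<boxtimes>\<^bsub>C\<^esub> \<mu>) \<cdot>\<^bsub>C\<^esub> Assoc C a a a \<and>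
       \<mu> \<cdot>\<^bsub>C\<^esub> (\<eta> \<boxtimes>\<^bsub>C\<^esub> Ident C a) = LUnit C a \<and>
       \<mu> \<cdot>\<^bsub>C\<^esub> (Ident C a \<boxtimes>\<^bsub>C\<^esub> \<eta>) = RUnit C a)"

text \<open>
  \<open>X i\<close> is the component of degree \<open>i\<close>, with the embeddings \<open>emb i\<close> and projections \<open>prj i\<close> of the
  decomposition, and \<open>mc i j\<close> is the component of the multiplication from \<open>X i \<otimes> X j\<close> to
  \<open>X (i + j)\<close>.
\<close>

definition is_graded_algebra ::
    "('o, 'm::ab_group_add, 'z) monoidal_category_scheme \<Rightarrow> ('o, 'm) algebra
      \<Rightarrow> ('g::{ab_group_add, finite} \<Rightarrow> 'o) \<Rightarrow> ('g \<Rightarrow> 'm) \<Rightarrow> ('g \<Rightarrow> 'm)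
      \<Rightarrow> ('g \<Rightarrow> 'g \<Rightarrow> 'm) \<Rightarrow> bool" where
  "is_graded_algebra C A X emb prj mc \<longleftrightarrow> is_algebra C A \<and>
     is_biproduct C UNIV X (alg_obj A) emb prj \<and>
     (\<forall>i j. mc i j \<in> Hom C (X i \<otimes>\<^bsub>C\<^esub> X j) (X (i + j)) \<and>
        alg_mult A \<cdot>\<^bsub>C\<^esub> (emb i \<boxtimes>\<^bsub>C\<^esub> emb j) = emb (i + j) \<cdot>\<^bsub>C\<^esub> mc i j)"

definition is_right_module ::
    "('o, 'm, 'z) monoidal_category_scheme \<Rightarrow> ('o, 'm) algebra \<Rightarrow> 'o \<times> 'm \<Rightarrow> bool" where
  "is_right_module C A M \<longleftrightarrow>
     (let a = alg_obj A; m = fst M; \<rho> = snd M in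
       m \<in> Obj C \<and> \<rho> \<in> Hom C (m \<otimes>\<^bsub>C\<^esub> a) m \<and>
       \<rho> \<cdot>\<^bsub>C\<^esub> (\<rho> \<boxtimes>\<^bsub>C\<^esub> Ident C a) =
         \<rho> \<cdot>\<^bsub>C\<^esub> (Ident C m \<boxtimes>\<^bsub>C\<^esub> alg_mult A) \<cdot>\<^bsub>C\<^esub> Assoc C m a a \<and>
       \<rho> \<cdot>\<^bsub>C\<^esub> (Ident C m \<boxtimes>\<^bsub>C\<^esub> alg_unit A) = RUnit C m)"

definition module_morphisms ::
    "('o, 'm, 'z) monoidal_category_scheme \<Rightarrow> ('o, 'm) algebra
      \<Rightarrow> 'o \<times> 'm \<Rightarrow> 'o \<times> 'm \<Rightarrow> 'm set" where
  "module_morphisms C A M N =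
     {f \<in> Hom C (fst M) (fst N).
        f \<cdot>\<^bsub>C\<^esub> snd M = snd N \<cdot>\<^bsub>C\<^esub> (f \<boxtimes>\<^bsub>C\<^esub> Ident C (alg_obj A))}"

definition mod_cat ::
    "('o, 'm, 'z) monoidal_category_scheme \<Rightarrow> ('o, 'm) algebra \<Rightarrow> ('o \<times> 'm, 'm) category" where
  "mod_cat C A = \<lparr>Obj = {M. is_right_module C A M}, Hom = module_morphisms C A,
     Comp = Comp C, Ident = (\<lambda>M. Ident C (fst M))\<rparr>"

definition Ind ::
    "('o, 'm, 'z) monoidal_category_scheme \<Rightarrow> ('o, 'm) algebra \<Rightarrow> 'o \<Rightarrow> 'o \<times> 'm" where
  "Ind C A x = (x \<otimes>\<^bsub>C\<^esub> alg_obj A,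
     (Ident C x \<boxtimes>\<^bsub>C\<^esub> alg_mult A) \<cdot>\<^bsub>C\<^esub> Assoc C x (alg_obj A) (alg_obj A))"

definition ind_cat ::
    "('o, 'm, 'z) monoidal_category_scheme \<Rightarrow> ('o, 'm) algebra \<Rightarrow> ('o \<times> 'm, 'm) category" where
  "ind_cat C A = full_subcategory (mod_cat C A) (Ind C A ` Obj C)"

text \<open>
  The degree-\<open>i\<close> morphisms \<open>Ind x \<rightarrow> Ind y\<close>: those whose restriction to each \<open>x \<otimes> X j\<close> factors
  through \<open>y \<otimes> X (i + j)\<close>.
\<close>

definition hom_degree ::
    "('o, 'm, 'z) monoidal_category_scheme \<Rightarrow> ('o, 'm) algebra
      \<Rightarrow> ('g::ab_group_add \<Rightarrow> 'o) \<Rightarrow> ('g \<Rightarrow> 'm) \<Rightarrow> 'o \<Rightarrow> 'o \<Rightarrow> 'g \<Rightarrow> 'm set" where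
  "hom_degree C A X emb x y i =
     {f \<in> Hom (ind_cat C A) (Ind C A x) (Ind C A y).
        \<forall>j. \<exists>g\<in>Hom C (x \<otimes>\<^bsub>C\<^esub> X j) (y \<otimes>\<^bsub>C\<^esub> X (i + j)).
          f \<cdot>\<^bsub>C\<^esub> (Ident C x \<boxtimes>\<^bsub>C\<^esub> emb j) = (Ident C y \<boxtimes>\<^bsub>C\<^esub> emb (i + j)) \<cdot>\<^bsub>C\<^esub> g}"


section \<open>Twisted group algebras\<close>

text \<open>
  The group \<open>\<Gamma>\<close> is the type \<open>'g\<close>; its embedding into the Picard group is given by the
  representatives \<open>L i\<close>. The unit of \<open>A\<close> is an isomorphism \<open>\<one> \<rightarrow> L 0\<close> followed by the embedding of
  \<open>L 0\<close>; requiring \<open>A\<close> to be an algebra normalises that isomorphism. (Associativity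
  is a consequence of the conditions on \<open>\<psi>\<close> and \<open>\<omega>\<close>.)
\<close>

locale twisted_group_algebra = abelian_monoidal_category scale C
  for scale :: "'k::field \<Rightarrow> 'm::ab_group_add \<Rightarrow> 'm"  (infixr \<open>*s\<close> 75)
    and C :: "('o, 'm, 'z) monoidal_category_scheme"  (structure) +
  fixes L :: "'g::{ab_group_add, finite} \<Rightarrow> 'o"
    and lam :: "'g \<Rightarrow> 'g \<Rightarrow> 'm"
    and \<psi> :: "'g \<Rightarrow> 'g \<Rightarrow> 'g \<Rightarrow> 'k"
    and \<omega> :: "'g \<Rightarrow> 'g \<Rightarrow> 'k"
    and A :: "('o, 'm) algebra"
    and emb :: "'g \<Rightarrow> 'm"
    and prj :: "'g \<Rightarrow> 'm"
  assumes L_invertible: "invertible_object C (L i)"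
    and L_zero: "isomorphic C (L 0) \<one>"
    and L_add: "isomorphic C (L (i + j)) (L i \<otimes> L j)"
    and L_distinct: "i \<noteq> j \<Longrightarrow> \<not> isomorphic C (L i) (L j)"
    and lam_hom: "lam i j \<in> Hom C (L i \<otimes> L j) (L (i + j))"
    and lam_basis: "bij_betw (\<lambda>c. c *s lam i j) UNIV (Hom C (L i \<otimes> L j) (L (i + j)))"
    and \<psi>_nonzero: "\<psi> i j k \<noteq> 0"
    and lam_assoc: "lam (i + j) k \<cdot> (lam i j \<boxtimes> Ident C (L k)) =
        inverse (\<psi> i j k) *s
          (lam i (j + k) \<cdot> (Ident C (L i) \<boxtimes> lam j k) \<cdot> Assoc C (L i) (L j) (L k))"
    and \<omega>_nonzero: "\<omega> i j \<noteq> 0"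
    and \<omega>_twist: "\<omega> i j * \<omega> (i + j) k = \<omega> j k * \<omega> i (j + k) * \<psi> i j k"
    and A_graded: "is_graded_algebra C A L emb prj (\<lambda>i j. \<omega> i j *s lam i j)"
    and A_unit: "\<exists>u. is_iso C \<one> (L 0) u \<and> alg_unit A = emb 0 \<cdot> u"


section \<open>Graded vector spaces\<close>

text \<open>
  \<open>V\<close> and \<open>W\<close> are graded subspaces with homogeneous components \<open>Vg i\<close> and \<open>Wg i\<close>; they are
  isomorphic by a linear map that is homogeneous of degree \<open>d\<close>. For a morphism \<open>f: Ind x \<rightarrow> Ind y\<close>
  that is invertible and homogeneous of degree \<open>i\<close>, composition with the inverse of \<open>f\<close> is such a
  map from \<open>Hom (Ind x) (Ind y)\<close> to the endomorphisms of \<open>Ind x\<close> and of \<open>Ind y\<close>, with \<open>d = - i\<close>.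
  The degree cannot be taken to be 0: in the category of \<open>\<Gamma>\<close>-graded vector spaces, with \<open>A\<close> the
  group algebra, the endomorphisms of \<open>Ind \<one>\<close> are concentrated in degree 0, but the
  one-dimensional space \<open>Hom (Ind \<one>) (Ind (L i))\<close> is concentrated in degree \<open>- i\<close>.
\<close>

definition graded_isomorphic_by ::
    "('k \<Rightarrow> 'm \<Rightarrow> 'm::ab_group_add) \<Rightarrow> 'g::ab_group_add
      \<Rightarrow> 'm set \<Rightarrow> ('g \<Rightarrow> 'm set) \<Rightarrow> 'm set \<Rightarrow> ('g \<Rightarrow> 'm set) \<Rightarrow> bool" where
  "graded_isomorphic_by scale d V Vg W Wg \<longleftrightarrow>
     (\<exists>\<phi>. bij_betw \<phi> V W \<and>
        (\<forall>u\<in>V. \<forall>v\<in>V. \<phi> (u + v) = \<phi> u + \<phi> v) \<and>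
        (\<forall>c. \<forall>v\<in>V. \<phi> (scale c v) = scale c (\<phi> v)) \<and>
        (\<forall>i. \<phi> ` Vg i = Wg (i + d)))"

end

theory Submission
  imports Defs
begin

text \<open>
  A non-zero morphism \<open>f: Ind x \<rightarrow> Ind y\<close> of degree \<open>i\<close> restricts to \<open>g: x \<otimes> L (- i) \<rightarrow> y \<otimes> L 0 \<cong> y\<close>.
  The cokernel \<open>c: y \<rightarrow> q\<close> of \<open>g\<close> induces an epimorphism \<open>Ind y \<rightarrow> Ind q\<close>, which by simplicity of
  \<open>Ind y\<close> is invertible or zero. Its composite with \<open>f\<close> vanishes on the component \<open>x \<otimes> L (- i)\<close>,
  which generates \<open>Ind x\<close>, hence is zero; so the epimorphism is not invertible and \<open>c = 0\<close>. Thus \<open>g\<close>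
  is epi, then so is \<open>f\<close>, and simplicity of \<open>Ind x\<close> makes \<open>f\<close> invertible. A non-zero morphism has a
  non-zero homogeneous component, whose inverse identifies the Hom space with both endomorphism
  spaces.
\<close>

text \<open>Nothing is assumed about exactness of \<otimes>, and \<open>ind_cat C A\<close> is only
  known to be linear, so the map induced by an epimorphism of C cannot be called epi outright. The
  substitute is a test on one component: a morphism of ind-A is epi once a single restriction
  between components is epi in C, because a morphism of ind-A that vanishes on one component is
  zero. Target degree 0 is singled out because tensoring with \<open>L 0\<close> is naturally
  isomorphic to the identity functor. This serves twice: the cokernel starts at y itself, so it can
  be induced, and its being epi carries over to \<open>c \<boxtimes> Ident C (L 0)\<close>. The
  cokernel is formed in C before inducing, since quotient simplicity only speaks about quotients
  that are themselves induced modules. The second obstacle is that cutting an arbitrary f into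
  blocks uses projections that in general are not module morphisms; all blocks with the same shift
  of degree must be summed before the result commutes with the action.\<close>

section \<open>Linear categories\<close>

context linear_category
begin

text \<open>Hom-sets may overlap and all laws of composition are guarded by typing, so source,
  target and their membership in \<open>Obj C\<close> are carried as one fact. The laws restated for
  \<open>arr\<close> then chain by \<open>OF\<close>.\<close>

definition arr :: "'m \<Rightarrow> 'o \<Rightarrow> 'o \<Rightarrow> bool" where
  "arr f x y \<longleftrightarrow> x \<in> Obj C \<and> y \<in> Obj C \<and> f \<in> Hom C x y"

lemma arr_ident: "x \<in> Obj C \<Longrightarrow> arr (Ident C x) x x"
  by (simp add: arr_def ident_hom)

lemma arr_comp: "\<lbrakk>arr f x y; arr g y z\<rbrakk> \<Longrightarrow> arr (g \<cdot> f) x z"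
  by (auto simp: arr_def intro: comp_hom)

lemma arr_zero: "\<lbrakk>x \<in> Obj C; y \<in> Obj C\<rbrakk> \<Longrightarrow> arr 0 x y"
  by (simp add: arr_def hom_subspace subspace_0)

lemma arr_add: "\<lbrakk>arr f x y; arr g x y\<rbrakk> \<Longrightarrow> arr (f + g) x y"
  by (simp add: arr_def hom_subspace subspace_add)

lemma arr_diff: "\<lbrakk>arr f x y; arr g x y\<rbrakk> \<Longrightarrow> arr (f - g) x y"
  by (simp add: arr_def hom_subspace subspace_diff)

lemma arr_scale: "arr f x y \<Longrightarrow> arr (c *s f) x y"
  by (simp add: arr_def hom_subspace subspace_scale)

lemma arr_sum:
  assumes "x \<in> Obj C" "y \<in> Obj C" "\<And>i. i \<in> I \<Longrightarrow> arr (f i) x y"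
  shows "arr (\<Sum>i\<in>I. f i) x y"
  using assms(3)
  by (induction I rule: infinite_finite_induct) (auto simp: assms(1,2) arr_zero arr_add)

lemma arr_ident_right: "arr f x y \<Longrightarrow> f \<cdot> Ident C x = f"
  by (auto simp: arr_def comp_ident_right)

lemma arr_ident_left: "arr f x y \<Longrightarrow> Ident C y \<cdot> f = f"
  by (auto simp: arr_def comp_ident_left)

lemma arr_assoc: "\<lbrakk>arr f w x; arr g x y; arr h y z\<rbrakk> \<Longrightarrow> (h \<cdot> g) \<cdot> f = h \<cdot> (g \<cdot> f)"
  unfolding arr_def by (blast intro: comp_assoc)

lemma arr_comp_add_right: "\<lbrakk>arr f x y; arr f' x y; arr g y z\<rbrakk> \<Longrightarrow> g \<cdot> (f + f') = g \<cdot> f + g \<cdot> f'"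
  unfolding arr_def by (blast intro: comp_add_right)

lemma arr_comp_add_left: "\<lbrakk>arr f x y; arr g y z; arr g' y z\<rbrakk> \<Longrightarrow> (g + g') \<cdot> f = g \<cdot> f + g' \<cdot> f"
  unfolding arr_def by (blast intro: comp_add_left)

lemma arr_comp_scale_right: "\<lbrakk>arr f x y; arr g y z\<rbrakk> \<Longrightarrow> g \<cdot> (c *s f) = c *s (g \<cdot> f)"
  unfolding arr_def by (blast intro: comp_scale_right)

lemma arr_comp_scale_left: "\<lbrakk>arr f x y; arr g y z\<rbrakk> \<Longrightarrow> (c *s g) \<cdot> f = c *s (g \<cdot> f)"
  unfolding arr_def by (blast intro: comp_scale_left)

lemma comp_zero_right: "\<lbrakk>arr g y z; x \<in> Obj C\<rbrakk> \<Longrightarrow> g \<cdot> 0 = 0"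
  using arr_comp_scale_right[of 0 x y g z 0] arr_zero[of x y] by (simp add: arr_def)

lemma comp_zero_left: "\<lbrakk>arr f x y; z \<in> Obj C\<rbrakk> \<Longrightarrow> 0 \<cdot> f = 0"
  using arr_comp_scale_left[of f x y 0 z 0] arr_zero[of y z] by (simp add: arr_def)

lemma comp_diff_left: "\<lbrakk>arr f x y; arr g y z; arr g' y z\<rbrakk> \<Longrightarrow> (g - g') \<cdot> f = g \<cdot> f - g' \<cdot> f"
  using arr_comp_add_left[of f x y "g - g'" z g'] by (simp add: arr_diff)

lemma comp_sum_left:
  assumes f: "arr f x y" and z: "z \<in> Obj C" and g: "\<And>i. i \<in> I \<Longrightarrow> arr (g i) y z"
  shows "(\<Sum>i\<in>I. g i) \<cdot> f = (\<Sum>i\<in>I. g i \<cdot> f)"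
  using g
proof (induction I rule: infinite_finite_induct)
  case (insert i I)
  have y: "y \<in> Obj C" using f by (simp add: arr_def)
  show ?case
    using insert arr_comp_add_left[OF f, of "g i" z "\<Sum>i\<in>I. g i"] arr_sum[of y z I g] y z
    by simp
qed (use comp_zero_left[OF f z] in auto)

lemma comp_sum_right:
  assumes x: "x \<in> Obj C" and g: "arr g y z" and f: "\<And>i. i \<in> I \<Longrightarrow> arr (f i) x y"
  shows "g \<cdot> (\<Sum>i\<in>I. f i) = (\<Sum>i\<in>I. g \<cdot> f i)"
  using f
proof (induction I rule: infinite_finite_induct)
  case (insert i I)
  have y: "y \<in> Obj C" using g by (simp add: arr_def)
  show ?case
    using insert arr_comp_add_right[OF _ _ g, of "f i" x "\<Sum>i\<in>I. f i"] arr_sum[of x y I f] y x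
    by simp
qed (use comp_zero_right[OF g x] in auto)

section \<open>Epimorphisms, cokernels and quotient objects\<close>

lemma is_epiI:
  assumes f: "arr f x y" and cancel: "\<And>z g. \<lbrakk>arr g y z; g \<cdot> f = 0\<rbrakk> \<Longrightarrow> g = 0"
  shows "is_epi C x y f"
  unfolding is_epi_def
proof (intro conjI ballI impI)
  fix z g h assume *: "z \<in> Obj C" "g \<in> Hom C y z" "h \<in> Hom C y z" "g \<cdot> f = h \<cdot> f"
  then have "arr g y z" "arr h y z" using f by (simp_all add: arr_def)
  then show "g = h"
    using cancel[of "g - h" z] comp_diff_left[OF f, of g z h] *(4) by (simp add: arr_diff)
qed (use f in \<open>simp_all add: arr_def\<close>)

lemma is_epi_cancel: "\<lbrakk>is_epi C x y f; arr g y z; g \<cdot> f = 0\<rbrakk> \<Longrightarrow> g = 0"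
  using comp_zero_left[of f x y z] arr_zero[of y z] unfolding is_epi_def arr_def by metis

text \<open>If \<open>g \<cdot> e = 0\<close>, both g and 0 factor the zero morphism through e, and
  that factorisation is unique.\<close>

lemma is_cokernel_epi:
  assumes "is_cokernel C x y f c e" "arr f x y"
  shows "is_epi C y c e"
proof (rule is_epiI)
  show e: "arr e y c" using assms by (simp add: is_cokernel_def arr_def)
  fix z g assume g: "arr g c z" and "g \<cdot> e = 0"
  moreover have z: "z \<in> Obj C" using g by (simp add: arr_def)
  moreover have "\<exists>!h. h \<in> Hom C c z \<and> h \<cdot> e = 0"
  proof -
    have "0 \<in> Hom C y z" "0 \<cdot> f = 0"
      using arr_zero[of y z] comp_zero_left[OF assms(2) z] assms(2) z by (simp_all add: arr_def)
    then show ?thesis using assms(1) z unfolding is_cokernel_def by blast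
  qed
  moreover have "0 \<in> Hom C c z" "0 \<cdot> e = 0"
    using arr_zero[of c z] comp_zero_left[OF e z] g by (simp_all add: arr_def)
  ultimately show "g = 0" unfolding arr_def by blast
qed

lemma epi_if_cokernel_zero:
  assumes "is_cokernel C x y f c 0" "arr f x y"
  shows "is_epi C x y f"
proof (rule is_epiI[OF assms(2)])
  fix z g assume g: "arr g y z" "g \<cdot> f = 0"
  then obtain h where "h \<in> Hom C c z" "h \<cdot> 0 = g"
    using assms(1) unfolding is_cokernel_def arr_def by blast
  then show "g = 0"
    using comp_zero_right[of h c z y] assms g by (simp add: is_cokernel_def arr_def)
qed

text \<open>The class of \<open>(y, e)\<close> contains \<open>(y, e)\<close> and must be one of the
  two available classes. Membership in the class of the identity produces an isomorphism equal to
  \<open>e\<close>; membership in the class of zero writes \<open>e\<close> as a composite with 0.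
  Simplicity enters the proof only in this form, applied to ind-A.\<close>

lemma quotient_simple_epi:
  assumes simple: "quotient_simple C x" and e: "is_epi C x y e"
  shows "e = 0 \<or> is_iso C x y e"
proof -
  obtain z where z: "zero_object C z" and
    Q: "quotient_objects C x = {quotient_class C x (x, Ident C x), quotient_class C x (z, 0)}"
    using simple unfolding quotient_simple_def by blast
  have arr_e: "arr e x y" using e by (simp add: is_epi_def arr_def)
  have "is_iso C y y (Ident C y)" "Ident C y \<cdot> e = e"
    using arr_e arr_ident[of y] arr_ident_left[OF arr_e] arr_ident_left[OF arr_ident[of y]]
    by (auto simp: is_iso_def arr_def)
  then have refl: "(y, e) \<in> quotient_class C x (y, e)"
    using e by (auto simp: quotient_class_def quotient_rel_def epis_from_def)
  have "quotient_class C x (y, e) \<in> quotient_objects C x"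
    using e by (auto simp: quotient_objects_def quotient_class_def epis_from_def quotient_def)
  with refl Q consider "(y, e) \<in> quotient_class C x (x, Ident C x)"
    | "(y, e) \<in> quotient_class C x (z, 0)" by auto
  then show ?thesis
  proof cases
    case 1
    then obtain h where h: "is_iso C x y h" "h \<cdot> Ident C x = e"
      by (auto simp: quotient_class_def quotient_rel_def)
    then have "h = e" using arr_ident_right[of h x y] by (simp add: is_iso_def arr_def)
    with h show ?thesis by simp
  next
    case 2
    then obtain h where h: "is_iso C z y h" "h \<cdot> 0 = e"
      by (auto simp: quotient_class_def quotient_rel_def)
    then have "e = 0" using comp_zero_right[of h z y x] arr_e by (simp add: is_iso_def arr_def)
    then show ?thesis by simp
  qed
qed

section \<open>Biproducts: equality of morphisms and the idempotents of the components\<close>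

lemma biproduct_emb: "\<lbrakk>is_biproduct C I X P e p; i \<in> I\<rbrakk> \<Longrightarrow> arr (e i) (X i) P"
  by (simp add: is_biproduct_def arr_def)

lemma biproduct_prj: "\<lbrakk>is_biproduct C I X P e p; i \<in> I\<rbrakk> \<Longrightarrow> arr (p i) P (X i)"
  by (simp add: is_biproduct_def arr_def)

text \<open>Composing with the identity, written as the sum of the \<open>e i \<cdot> p i\<close>,
  rebuilds a morphism out of P from its restrictions. Vanishing, degree and module conditions are
  later reduced to components through it.\<close>

lemma biproduct_eqI:
  assumes P: "is_biproduct C I X P e p" and f: "arr f P z" and g: "arr g P z"
    and eq: "\<And>i. i \<in> I \<Longrightarrow> f \<cdot> e i = g \<cdot> e i"
  shows "f = g"
proof -
  have ep: "arr (e i \<cdot> p i) P P" if "i \<in> I" for i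
    using biproduct_emb[OF P that] biproduct_prj[OF P that] by (rule arr_comp[rotated])
  have *: "h = (\<Sum>i\<in>I. (h \<cdot> e i) \<cdot> p i)" if h: "arr h P z" for h
  proof -
    have "h = h \<cdot> (\<Sum>i\<in>I. e i \<cdot> p i)"
      using P arr_ident_right[OF h] by (simp add: is_biproduct_def)
    also have "\<dots> = (\<Sum>i\<in>I. h \<cdot> e i \<cdot> p i)"
      using P h ep by (intro comp_sum_right) (auto simp: arr_def)
    also have "\<dots> = (\<Sum>i\<in>I. (h \<cdot> e i) \<cdot> p i)"
      using arr_assoc[OF biproduct_prj[OF P] biproduct_emb[OF P] h] by (intro sum.cong) auto
    finally show ?thesis .
  qed
  show ?thesis using *[OF f] *[OF g] eq by simp
qed

lemma biproduct_idem:
  assumes P: "is_biproduct C I X P e p" and "i \<in> I" "j \<in> I"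
  shows "(e i \<cdot> p i) \<cdot> e j = (if i = j then e j else 0)"
proof -
  have "(e i \<cdot> p i) \<cdot> e j = e i \<cdot> p i \<cdot> e j"
    using assms by (intro arr_assoc) (auto intro: biproduct_emb biproduct_prj)
  also have "p i \<cdot> e j = (if i = j then Ident C (X i) else 0)"
    using assms by (simp add: is_biproduct_def)
  also have "e i \<cdot> \<dots> = (if i = j then e j else 0)"
    using arr_ident_right[OF biproduct_emb[OF P \<open>i \<in> I\<close>]]
      comp_zero_right[OF biproduct_emb[OF P \<open>i \<in> I\<close>], of "X j"] assms
    by (auto simp: is_biproduct_def)
  finally show ?thesis .
qed

section \<open>Isomorphisms and transport along them\<close>

lemma is_iso_obtain:
  assumes "is_iso C x y f"
  obtains g where "arr f x y" "arr g y x" "g \<cdot> f = Ident C x" "f \<cdot> g = Ident C y"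
  using assms unfolding is_iso_def arr_def by blast

lemma is_isoI:
  "\<lbrakk>arr f x y; arr g y x; g \<cdot> f = Ident C x; f \<cdot> g = Ident C y\<rbrakk> \<Longrightarrow> is_iso C x y f"
  unfolding is_iso_def arr_def by blast

lemma is_iso_comp:
  assumes "is_iso C x y f" "is_iso C y z g"
  shows "is_iso C x z (g \<cdot> f)"
proof -
  obtain f' where f: "arr f x y" "arr f' y x" "f' \<cdot> f = Ident C x" "f \<cdot> f' = Ident C y"
    using assms(1) by (rule is_iso_obtain)
  obtain g' where g: "arr g y z" "arr g' z y" "g' \<cdot> g = Ident C y" "g \<cdot> g' = Ident C z"
    using assms(2) by (rule is_iso_obtain)
  have "g' \<cdot> g \<cdot> f = f"
    using arr_assoc[OF f(1) g(1,2)] g(3) arr_ident_left[OF f(1)] by simp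
  moreover have "f \<cdot> f' \<cdot> g' = g'"
    using arr_assoc[OF g(2) f(2,1)] f(4) arr_ident_left[OF g(2)] by simp
  moreover have "(f' \<cdot> g') \<cdot> g \<cdot> f = f' \<cdot> g' \<cdot> g \<cdot> f"
    "(g \<cdot> f) \<cdot> f' \<cdot> g' = g \<cdot> f \<cdot> f' \<cdot> g'"
    using arr_assoc[OF arr_comp[OF f(1) g(1)] g(2) f(2)]
      arr_assoc[OF arr_comp[OF g(2) f(2)] f(1) g(1)] by simp_all
  ultimately show ?thesis
    using f g by (intro is_isoI[of _ _ _ "f' \<cdot> g'"]) (auto intro: arr_comp)
qed

text \<open>Inverting t and s in the square shows that \<open>k \<cdot> d = 0\<close> forces
  \<open>(k \<cdot> t') \<cdot> c = 0\<close>. One use has a naturality square and passes from a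
  cokernel c to \<open>c \<boxtimes> Ident C (L 0)\<close>; the other has an identity for s and
  strips an isomorphism off the target.\<close>

lemma epi_transfer:
  assumes c: "is_epi C y q c" and s: "is_iso C y' y s" and t: "is_iso C q' q t"
    and d: "arr d y' q'" and square: "t \<cdot> d = c \<cdot> s"
  shows "is_epi C y' q' d"
proof (rule is_epiI[OF d])
  fix z k assume k: "arr k q' z" and kd: "k \<cdot> d = 0"
  obtain s' where s: "arr s y' y" "arr s' y y'" "s \<cdot> s' = Ident C y"
    using s by (rule is_iso_obtain)
  obtain t' where t: "arr t q' q" "arr t' q q'" "t' \<cdot> t = Ident C q'"
    using t by (rule is_iso_obtain)
  have c': "arr c y q" using c by (simp add: is_epi_def arr_def)
  have ds': "arr (d \<cdot> s') y q'" by (rule arr_comp[OF s(2) d])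
  have "d \<cdot> s' = (t' \<cdot> t) \<cdot> d \<cdot> s'" using t(3) arr_ident_left[OF ds'] by simp
  also have "\<dots> = t' \<cdot> (t \<cdot> d) \<cdot> s'"
    using arr_assoc[OF ds' t(1,2)] arr_assoc[OF s(2) d t(1)] by simp
  also have "\<dots> = t' \<cdot> c"
    using square arr_assoc[OF s(2,1) c'] s(3) arr_ident_right[OF c'] by simp
  finally have "(k \<cdot> t') \<cdot> c = (k \<cdot> d) \<cdot> s'"
    using arr_assoc[OF s(2) d k] arr_assoc[OF c' t(2) k] by simp
  also have "\<dots> = 0" using kd comp_zero_left[OF s(2), of z] k by (simp add: arr_def)
  finally have "k \<cdot> t' = 0" using is_epi_cancel[OF c arr_comp[OF t(2) k]] by simp
  then show "k = 0"
    using arr_assoc[OF t(1,2) k] t(3) arr_ident_right[OF k] comp_zero_left[OF t(1), of z] k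
    by (simp add: arr_def)
qed

lemma bij_betw_postcomp_iso:
  assumes x: "x \<in> Obj C" and f: "arr f y z" "arr f' z y" "f' \<cdot> f = Ident C y" "f \<cdot> f' = Ident C z"
  shows "bij_betw ((\<cdot>) f) (Hom C x y) (Hom C x z)"
proof (rule bij_betw_byWitness[where f' = "(\<cdot>) f'"])
  have *: "arr g x w \<longleftrightarrow> g \<in> Hom C x w" if "w \<in> {y, z}" for g w
    using that x f(1) by (auto simp: arr_def)
  show "\<forall>g\<in>Hom C x y. f' \<cdot> f \<cdot> g = g"
    using arr_assoc[OF _ f(1,2)] f(3) arr_ident_left * by fastforce
  show "\<forall>g\<in>Hom C x z. f \<cdot> f' \<cdot> g = g"
    using arr_assoc[OF _ f(2,1)] f(4) arr_ident_left * by fastforce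
  show "(\<cdot>) f ` Hom C x y \<subseteq> Hom C x z" "(\<cdot>) f' ` Hom C x z \<subseteq> Hom C x y"
    using * f(1,2) by (auto simp flip: * intro: arr_comp)
qed

lemma bij_betw_precomp_iso:
  assumes x: "x \<in> Obj C" and f: "arr f y z" "arr f' z y" "f' \<cdot> f = Ident C y" "f \<cdot> f' = Ident C z"
  shows "bij_betw (\<lambda>g. g \<cdot> f) (Hom C z x) (Hom C y x)"
proof (rule bij_betw_byWitness[where f' = "\<lambda>g. g \<cdot> f'"])
  have *: "arr g w x \<longleftrightarrow> g \<in> Hom C w x" if "w \<in> {y, z}" for g w
    using that x f(1) by (auto simp: arr_def)
  show "\<forall>g\<in>Hom C z x. (g \<cdot> f) \<cdot> f' = g"
    using arr_assoc[OF f(2,1)] f(4) arr_ident_right * by fastforce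
  show "\<forall>g\<in>Hom C y x. (g \<cdot> f') \<cdot> f = g"
    using arr_assoc[OF f(1,2)] f(3) arr_ident_right * by fastforce
  show "(\<lambda>g. g \<cdot> f) ` Hom C z x \<subseteq> Hom C y x" "(\<lambda>g. g \<cdot> f') ` Hom C y x \<subseteq> Hom C z x"
    using * f(1,2) by (auto simp flip: * intro: arr_comp)
qed

end


section \<open>Monoidal categories\<close>

context abelian_monoidal_category
begin

lemma arr_tens: "\<lbrakk>arr f x y; arr f' x' y'\<rbrakk> \<Longrightarrow> arr (f \<boxtimes> f') (x \<otimes> x') (y \<otimes> y')"
  by (simp add: arr_def tens_obj tens_hom)

lemma arr_tens_comp: "\<lbrakk>arr f x y; arr g y z; arr f' x' y'; arr g' y' z'\<rbrakk>
    \<Longrightarrow> (g \<cdot> f) \<boxtimes> (g' \<cdot> f') = (g \<boxtimes> g') \<cdot> (f \<boxtimes> f')"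
  unfolding arr_def by (blast intro: tens_comp)

lemma tens_zero_left: "\<lbrakk>x \<in> Obj C; y \<in> Obj C; arr f x' y'\<rbrakk> \<Longrightarrow> 0 \<boxtimes> f = 0"
  using tens_scale_left[of x y x' y' 0 f 0] arr_zero[of x y] by (simp add: arr_def)

lemma tens_zero_right: "\<lbrakk>x' \<in> Obj C; y' \<in> Obj C; arr f x y\<rbrakk> \<Longrightarrow> f \<boxtimes> 0 = 0"
  using tens_scale_right[of x y x' y' f 0 0] arr_zero[of x' y'] by (simp add: arr_def)

lemma tens_sum_right:
  assumes f: "arr f x y" and xy: "x' \<in> Obj C" "y' \<in> Obj C"
    and g: "\<And>i. i \<in> I \<Longrightarrow> arr (g i) x' y'"
  shows "f \<boxtimes> (\<Sum>i\<in>I. g i) = (\<Sum>i\<in>I. f \<boxtimes> g i)"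
  using g
proof (induction I rule: infinite_finite_induct)
  case (insert i I)
  then show ?case
    using tens_add_right[of x y x' y' f "g i" "\<Sum>i\<in>I. g i"] arr_sum[OF xy, of I g] f xy
    by (simp add: arr_def)
qed (use tens_zero_right[OF xy f] in auto)

lemma tens_sum_left:
  assumes xy: "x \<in> Obj C" "y \<in> Obj C" and f: "arr f x' y'"
    and g: "\<And>i. i \<in> I \<Longrightarrow> arr (g i) x y"
  shows "(\<Sum>i\<in>I. g i) \<boxtimes> f = (\<Sum>i\<in>I. g i \<boxtimes> f)"
  using g
proof (induction I rule: infinite_finite_induct)
  case (insert i I)
  then show ?case
    using tens_add_left[of x y x' y' "g i" "\<Sum>i\<in>I. g i" f] arr_sum[OF xy, of I g] f xy
    by (simp add: arr_def)
qed (use tens_zero_left[OF xy f] in auto)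

text \<open>Biproducts are defined by equations, so any additive functor preserves them; bilinearity
  and interchange are all it takes. This decomposes \<open>x \<otimes> a\<close> into the
  \<open>x \<otimes> L j\<close>.\<close>

lemma biproduct_tens_left:
  assumes x: "x \<in> Obj C" and P: "is_biproduct C I X P e p"
  shows "is_biproduct C I (\<lambda>i. x \<otimes> X i) (x \<otimes> P) (\<lambda>i. Ident C x \<boxtimes> e i) (\<lambda>i. Ident C x \<boxtimes> p i)"
proof -
  have [simp]: "P \<in> Obj C" "\<And>i. i \<in> I \<Longrightarrow> X i \<in> Obj C" "finite I"
    using P by (auto simp: is_biproduct_def)
  note e = biproduct_emb[OF P] and p = biproduct_prj[OF P] and id = arr_ident[OF x]
  have idc: "Ident C x \<cdot> Ident C x = Ident C x" by (rule arr_ident_left[OF id])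
  have comp: "(Ident C x \<boxtimes> g) \<cdot> (Ident C x \<boxtimes> f) = Ident C x \<boxtimes> (g \<cdot> f)"
    if "arr f u v" "arr g v w" for f g u v w
    using arr_tens_comp[OF id id that] idc by simp
  have "(\<Sum>i\<in>I. (Ident C x \<boxtimes> e i) \<cdot> (Ident C x \<boxtimes> p i)) = (\<Sum>i\<in>I. Ident C x \<boxtimes> (e i \<cdot> p i))"
    using comp[OF p e] by simp
  also have "\<dots> = Ident C x \<boxtimes> (\<Sum>i\<in>I. e i \<cdot> p i)"
    by (rule tens_sum_right[symmetric, OF id, of P P]) (auto intro: arr_comp[OF p e])
  also have "\<dots> = Ident C (x \<otimes> P)"
    using P x by (simp add: is_biproduct_def tens_ident)
  finally have sum: "(\<Sum>i\<in>I. (Ident C x \<boxtimes> e i) \<cdot> (Ident C x \<boxtimes> p i)) = Ident C (x \<otimes> P)" .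
  have orth: "(Ident C x \<boxtimes> p i) \<cdot> (Ident C x \<boxtimes> e j) = (if i = j then Ident C (x \<otimes> X i) else 0)"
    if "i \<in> I" "j \<in> I" for i j
  proof -
    have "p i \<cdot> e j = (if i = j then Ident C (X i) else 0)"
      using P that by (simp add: is_biproduct_def)
    then show ?thesis
      using comp[OF e[OF that(2)] p[OF that(1)]] tens_zero_right[OF _ _ id, of "X j" "X i"] that x
      by (auto simp: tens_ident)
  qed
  show ?thesis
    unfolding is_biproduct_def
    using x sum orth arr_tens[OF id e] arr_tens[OF id p] by (auto simp: tens_obj arr_def)
qed

text \<open>Together with the left-hand version it cuts \<open>(x \<otimes> a) \<otimes> a\<close>,
  the source of the action, into the pieces \<open>(x \<otimes> L k) \<otimes> L l\<close> on which
  module conditions are verified.\<close>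

lemma biproduct_tens_right:
  assumes x: "x \<in> Obj C" and P: "is_biproduct C I X P e p"
  shows "is_biproduct C I (\<lambda>i. X i \<otimes> x) (P \<otimes> x) (\<lambda>i. e i \<boxtimes> Ident C x) (\<lambda>i. p i \<boxtimes> Ident C x)"
proof -
  have [simp]: "P \<in> Obj C" "\<And>i. i \<in> I \<Longrightarrow> X i \<in> Obj C" "finite I"
    using P by (auto simp: is_biproduct_def)
  note e = biproduct_emb[OF P] and p = biproduct_prj[OF P] and id = arr_ident[OF x]
  have idc: "Ident C x \<cdot> Ident C x = Ident C x" by (rule arr_ident_left[OF id])
  have comp: "(g \<boxtimes> Ident C x) \<cdot> (f \<boxtimes> Ident C x) = (g \<cdot> f) \<boxtimes> Ident C x"
    if "arr f u v" "arr g v w" for f g u v w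
    using arr_tens_comp[OF that id id] idc by simp
  have "(\<Sum>i\<in>I. (e i \<boxtimes> Ident C x) \<cdot> (p i \<boxtimes> Ident C x)) = (\<Sum>i\<in>I. (e i \<cdot> p i) \<boxtimes> Ident C x)"
    using comp[OF p e] by simp
  also have "\<dots> = (\<Sum>i\<in>I. e i \<cdot> p i) \<boxtimes> Ident C x"
    by (rule tens_sum_left[symmetric, of P P, OF _ _ id]) (auto intro: arr_comp[OF p e])
  also have "\<dots> = Ident C (P \<otimes> x)"
    using P x by (simp add: is_biproduct_def tens_ident)
  finally have sum: "(\<Sum>i\<in>I. (e i \<boxtimes> Ident C x) \<cdot> (p i \<boxtimes> Ident C x)) = Ident C (P \<otimes> x)" .
  have orth: "(p i \<boxtimes> Ident C x) \<cdot> (e j \<boxtimes> Ident C x) = (if i = j then Ident C (X i \<otimes> x) else 0)"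
    if "i \<in> I" "j \<in> I" for i j
  proof -
    have "p i \<cdot> e j = (if i = j then Ident C (X i) else 0)"
      using P that by (simp add: is_biproduct_def)
    then show ?thesis
      using comp[OF e[OF that(2)] p[OF that(1)]] tens_zero_left[OF _ _ id, of "X j" "X i"] that x
      by (auto simp: tens_ident)
  qed
  show ?thesis
    unfolding is_biproduct_def
    using x sum orth arr_tens[OF e id] arr_tens[OF p id] by (auto simp: tens_obj arr_def)
qed

lemma is_iso_tens_left:
  assumes x: "x \<in> Obj C" and "is_iso C y z f"
  shows "is_iso C (x \<otimes> y) (x \<otimes> z) (Ident C x \<boxtimes> f)"
proof -
  obtain f' where f: "arr f y z" "arr f' z y" "f' \<cdot> f = Ident C y" "f \<cdot> f' = Ident C z"
    using assms(2) by (rule is_iso_obtain)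
  note id = arr_ident[OF x]
  show ?thesis
  proof (rule is_isoI)
    show "arr (Ident C x \<boxtimes> f) (x \<otimes> y) (x \<otimes> z)" "arr (Ident C x \<boxtimes> f') (x \<otimes> z) (x \<otimes> y)"
      using f id by (auto intro: arr_tens)
    show "(Ident C x \<boxtimes> f') \<cdot> (Ident C x \<boxtimes> f) = Ident C (x \<otimes> y)"
      "(Ident C x \<boxtimes> f) \<cdot> (Ident C x \<boxtimes> f') = Ident C (x \<otimes> z)"
      using arr_tens_comp[OF id id f(1,2)] arr_tens_comp[OF id id f(2,1)] arr_ident_left[OF id]
        f x by (simp_all add: tens_ident arr_def)
  qed
qed

lemma arr_Assoc: "\<lbrakk>x \<in> Obj C; y \<in> Obj C; z \<in> Obj C\<rbrakk>
    \<Longrightarrow> arr (Assoc C x y z) ((x \<otimes> y) \<otimes> z) (x \<otimes> (y \<otimes> z))"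
  using assoc_iso by (simp add: is_iso_def arr_def)

lemma arr_assoc_natural: "\<lbrakk>arr f x x'; arr g y y'; arr h z z'\<rbrakk>
    \<Longrightarrow> Assoc C x' y' z' \<cdot> ((f \<boxtimes> g) \<boxtimes> h) = (f \<boxtimes> (g \<boxtimes> h)) \<cdot> Assoc C x y z"
  by (auto simp: arr_def assoc_natural)

end


section \<open>Induced modules over a twisted group algebra\<close>

context twisted_group_algebra
begin

abbreviation "a \<equiv> alg_obj A"
abbreviation "mc i j \<equiv> \<omega> i j *s lam i j"
abbreviation "E x j \<equiv> Ident C x \<boxtimes> emb j"
text \<open>The idempotent of \<open>x \<otimes> a\<close> onto its component of degree j. Using
  endomorphisms of \<open>x \<otimes> a\<close> instead of projections to
  \<open>x \<otimes> L j\<close> turns degree conditions into commutation rules. It is a morphism of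
  C, in general not one of modules.\<close>

abbreviation "P x j \<equiv> E x j \<cdot> (Ident C x \<boxtimes> prj j)"
abbreviation "act x \<equiv> (Ident C x \<boxtimes> alg_mult A) \<cdot> Assoc C x a a"

section \<open>Components of the algebra and of induced modules\<close>

lemma L_obj: "L i \<in> Obj C"
  using L_invertible[of i] by (simp add: invertible_object_def)

lemma a_obj: "a \<in> Obj C"
  using A_graded by (simp add: is_graded_algebra_def is_algebra_def Let_def)

lemma A_biproduct: "is_biproduct C UNIV L a emb prj"
  using A_graded by (simp add: is_graded_algebra_def)

lemma arr_emb: "arr (emb i) (L i) a"
  using biproduct_emb[OF A_biproduct] by simp

lemma arr_mult: "arr (alg_mult A) (a \<otimes> a) a"
  using A_graded by (simp add: is_graded_algebra_def is_algebra_def Let_def arr_def tens_obj)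

lemma arr_mc: "arr (mc i j) (L i \<otimes> L j) (L (i + j))"
  using A_graded by (simp add: is_graded_algebra_def arr_def tens_obj L_obj)

lemma mult_emb: "alg_mult A \<cdot> (emb i \<boxtimes> emb j) = emb (i + j) \<cdot> mc i j"
  using A_graded by (simp add: is_graded_algebra_def)

text \<open>The Hom space is spanned by \<open>lam i j\<close>, so the inverse g of the isomorphism
  h from \<open>L_add\<close> is some \<open>c *s lam i j\<close>. Rescaling h by
  \<open>c / \<omega> i j\<close> turns \<open>g \<cdot> h = id\<close> into a section of
  \<open>mc i j\<close>.\<close>

lemma mc_section:
  obtains s where "arr s (L (i + j)) (L i \<otimes> L j)" "mc i j \<cdot> s = Ident C (L (i + j))"
proof -
  obtain h g where h: "arr h (L (i + j)) (L i \<otimes> L j)" "arr g (L i \<otimes> L j) (L (i + j))"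
    "g \<cdot> h = Ident C (L (i + j))"
    using L_add[of i j] unfolding isomorphic_def by (meson is_iso_obtain)
  then obtain c where c: "g = c *s lam i j"
    using lam_basis[of i j] unfolding bij_betw_def arr_def by blast
  have lam: "arr (lam i j) (L i \<otimes> L j) (L (i + j))"
    using lam_hom[of i j] L_obj tens_obj by (simp add: arr_def)
  have "mc i j \<cdot> (c / \<omega> i j) *s h = Ident C (L (i + j))"
    using arr_comp_scale_left[OF h(1) lam] arr_comp_scale_right[OF h(1) arr_mc] \<omega>_nonzero h(3) c
    by simp
  then show thesis using that[OF arr_scale[OF h(1)]] by blast
qed

lemma arr_E: "x \<in> Obj C \<Longrightarrow> arr (E x j) (x \<otimes> L j) (x \<otimes> a)"
  by (intro arr_tens arr_ident arr_emb)

lemma Ind_biproduct: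
  "x \<in> Obj C \<Longrightarrow> is_biproduct C UNIV (\<lambda>j. x \<otimes> L j) (x \<otimes> a) (E x) (\<lambda>j. Ident C x \<boxtimes> prj j)"
  by (rule biproduct_tens_left[OF _ A_biproduct])

lemma arr_P: "x \<in> Obj C \<Longrightarrow> arr (P x j) (x \<otimes> a) (x \<otimes> a)"
  using biproduct_emb[OF Ind_biproduct] biproduct_prj[OF Ind_biproduct] by (blast intro: arr_comp)

lemma P_E: "x \<in> Obj C \<Longrightarrow> P x i \<cdot> E x j = (if i = j then E x j else 0)"
  using biproduct_idem[OF Ind_biproduct] by blast

lemma arr_act: "x \<in> Obj C \<Longrightarrow> arr (act x) ((x \<otimes> a) \<otimes> a) (x \<otimes> a)"
  by (rule arr_comp[OF arr_Assoc arr_tens[OF arr_ident arr_mult]]) (simp_all add: a_obj)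

section \<open>Morphisms of ind-A described inside C\<close>

lemma Obj_ind: "Obj (ind_cat C A) = Ind C A ` Obj C"
  by (simp add: ind_cat_def full_subcategory_def)

lemma Comp_ind [simp]: "Comp (ind_cat C A) = Comp C"
  by (simp add: ind_cat_def full_subcategory_def mod_cat_def)

lemma Ident_ind: "Ident (ind_cat C A) (Ind C A x) = Ident C (x \<otimes> a)"
  by (simp add: ind_cat_def full_subcategory_def mod_cat_def Ind_def)

lemma Hom_ind_iff:
  assumes "x \<in> Obj C" "y \<in> Obj C"
  shows "f \<in> Hom (ind_cat C A) (Ind C A x) (Ind C A y) \<longleftrightarrow>
    arr f (x \<otimes> a) (y \<otimes> a) \<and> f \<cdot> act x = act y \<cdot> (f \<boxtimes> Ident C a)"
  using assms
  by (auto simp: ind_cat_def full_subcategory_def mod_cat_def module_morphisms_def Ind_def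
      arr_def tens_obj a_obj)

text \<open>Naturality of the associator moves the embeddings inside, where \<open>mult_emb\<close>
  applies; hence n is the associator followed by \<open>Ident C x \<boxtimes> mc j l\<close>. The
  section r combines the inverse associator with the section of \<open>mc j l\<close>. The
  factorisation says that acting in degree l raises degrees by l, the section that all of
  \<open>x \<otimes> L (j + l)\<close> is reached.\<close>

lemma act_E:
  assumes x: "x \<in> Obj C"
  obtains n r where
    "arr n ((x \<otimes> L j) \<otimes> L l) (x \<otimes> L (j + l))" "arr r (x \<otimes> L (j + l)) ((x \<otimes> L j) \<otimes> L l)"
    "act x \<cdot> (E x j \<boxtimes> emb l) = E x (j + l) \<cdot> n" "n \<cdot> r = Ident C (x \<otimes> L (j + l))"
proof -
  let ?\<alpha> = "Assoc C x (L j) (L l)" and ?t = "\<lambda>f. Ident C x \<boxtimes> f"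
  note id = arr_ident[OF x] and L = L_obj[of j] L_obj[of l]
  have idid: "Ident C x \<cdot> Ident C x = Ident C x" by (rule arr_ident_left[OF id])
  have \<alpha>: "arr ?\<alpha> ((x \<otimes> L j) \<otimes> L l) (x \<otimes> (L j \<otimes> L l))" by (rule arr_Assoc[OF x L])
  have ee: "arr (emb j \<boxtimes> emb l) (L j \<otimes> L l) (a \<otimes> a)" by (intro arr_tens arr_emb)
  have Tee: "arr (?t (emb j \<boxtimes> emb l)) (x \<otimes> (L j \<otimes> L l)) (x \<otimes> (a \<otimes> a))"
    by (rule arr_tens[OF id ee])
  have T\<mu>: "arr (?t (alg_mult A)) (x \<otimes> (a \<otimes> a)) (x \<otimes> a)" by (rule arr_tens[OF id arr_mult])
  have Tm: "arr (?t (mc j l)) (x \<otimes> (L j \<otimes> L l)) (x \<otimes> L (j + l))" by (rule arr_tens[OF id arr_mc])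
  have n: "arr (?t (mc j l) \<cdot> ?\<alpha>) ((x \<otimes> L j) \<otimes> L l) (x \<otimes> L (j + l))" by (rule arr_comp[OF \<alpha> Tm])
  have "act x \<cdot> (E x j \<boxtimes> emb l) = ?t (alg_mult A) \<cdot> Assoc C x a a \<cdot> (E x j \<boxtimes> emb l)"
    by (rule arr_assoc[OF arr_tens[OF arr_E[OF x] arr_emb] arr_Assoc[OF x a_obj a_obj] T\<mu>])
  also have "\<dots> = ?t (alg_mult A) \<cdot> ?t (emb j \<boxtimes> emb l) \<cdot> ?\<alpha>"
    by (simp add: arr_assoc_natural[OF id arr_emb arr_emb])
  also have "\<dots> = ?t (emb (j + l) \<cdot> mc j l) \<cdot> ?\<alpha>"
    using arr_assoc[OF \<alpha> Tee T\<mu>] arr_tens_comp[OF id id ee arr_mult] idid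
    by (simp add: mult_emb)
  also have "\<dots> = E x (j + l) \<cdot> ?t (mc j l) \<cdot> ?\<alpha>"
    using arr_tens_comp[OF id id arr_mc arr_emb] arr_assoc[OF \<alpha> Tm arr_E[OF x]] idid by simp
  finally have act: "act x \<cdot> (E x j \<boxtimes> emb l) = E x (j + l) \<cdot> ?t (mc j l) \<cdot> ?\<alpha>" .
  obtain s where s: "arr s (L (j + l)) (L j \<otimes> L l)" "mc j l \<cdot> s = Ident C (L (j + l))"
    by (rule mc_section)
  obtain \<beta> where \<beta>: "arr \<beta> (x \<otimes> (L j \<otimes> L l)) ((x \<otimes> L j) \<otimes> L l)"
    "?\<alpha> \<cdot> \<beta> = Ident C (x \<otimes> (L j \<otimes> L l))"
    using assoc_iso[OF x L] by (rule is_iso_obtain)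
  have Ts: "arr (?t s) (x \<otimes> L (j + l)) (x \<otimes> (L j \<otimes> L l))" by (rule arr_tens[OF id s(1)])
  have r: "arr (\<beta> \<cdot> ?t s) (x \<otimes> L (j + l)) ((x \<otimes> L j) \<otimes> L l)" by (rule arr_comp[OF Ts \<beta>(1)])
  have "(?t (mc j l) \<cdot> ?\<alpha>) \<cdot> \<beta> \<cdot> ?t s = ?t (mc j l) \<cdot> (?\<alpha> \<cdot> \<beta>) \<cdot> ?t s"
    using arr_assoc[OF r \<alpha> Tm] arr_assoc[OF Ts \<beta>(1) \<alpha>] by simp
  also have "\<dots> = Ident C (x \<otimes> L (j + l))"
    using \<beta>(2) arr_ident_left[OF Ts] arr_tens_comp[OF id id s(1) arr_mc] idid s(2) x
    by (simp add: tens_ident L_obj)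
  finally show thesis using that[OF n r act] by blast
qed

text \<open>The module condition is linear in f and passes to composites by interchange, while
  composition and identities are those of C. This makes the results on epimorphisms, quotients and
  isomorphisms available for ind-A under the prefix \<open>ind\<close>.\<close>

sublocale ind: linear_category scale "ind_cat C A"
proof
  have id: "arr (Ident C a) a a" "Ident C a \<cdot> Ident C a = Ident C a"
    using arr_ident[OF a_obj] arr_ident_left by auto
  show "subspace (Hom (ind_cat C A) u v)" if uv: "u \<in> Obj (ind_cat C A)" "v \<in> Obj (ind_cat C A)" for u v
  proof -
    obtain x y where x: "x \<in> Obj C" "u = Ind C A x" and y: "y \<in> Obj C" "v = Ind C A y"
      using uv by (auto simp: Obj_ind)
    note xa = tens_obj[OF x(1) a_obj] and ya = tens_obj[OF y(1) a_obj]
    note act = arr_act[OF x(1)] arr_act[OF y(1)]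
    show ?thesis unfolding subspace_def
    proof (intro conjI allI ballI)
      show "0 \<in> Hom (ind_cat C A) u v"
        using comp_zero_left[OF act(1) ya] comp_zero_right[OF act(2), of "(x \<otimes> a) \<otimes> a"]
          tens_zero_left[OF xa ya id(1)] arr_zero[OF xa ya] x y xa
        by (simp add: Hom_ind_iff tens_obj a_obj)
    next
      fix f g assume "f \<in> Hom (ind_cat C A) u v" "g \<in> Hom (ind_cat C A) u v"
      then have f: "arr f (x \<otimes> a) (y \<otimes> a)" "f \<cdot> act x = act y \<cdot> (f \<boxtimes> Ident C a)"
        and g: "arr g (x \<otimes> a) (y \<otimes> a)" "g \<cdot> act x = act y \<cdot> (g \<boxtimes> Ident C a)"
        using x y by (simp_all add: Hom_ind_iff)
      have "(f + g) \<boxtimes> Ident C a = f \<boxtimes> Ident C a + g \<boxtimes> Ident C a"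
        using f(1) g(1) id(1) tens_add_left[of "x \<otimes> a" "y \<otimes> a" a a] by (simp add: arr_def)
      then show "f + g \<in> Hom (ind_cat C A) u v"
        using arr_add[OF f(1) g(1)] arr_comp_add_left[OF act(1) f(1) g(1)]
          arr_comp_add_right[OF arr_tens[OF f(1) id(1)] arr_tens[OF g(1) id(1)] act(2)] f(2) g(2) x y
        by (simp add: Hom_ind_iff)
    next
      fix c f assume "f \<in> Hom (ind_cat C A) u v"
      then have f: "arr f (x \<otimes> a) (y \<otimes> a)" "f \<cdot> act x = act y \<cdot> (f \<boxtimes> Ident C a)"
        using x y by (simp_all add: Hom_ind_iff)
      have "(c *s f) \<boxtimes> Ident C a = c *s (f \<boxtimes> Ident C a)"
        using f(1) id(1) tens_scale_left[of "x \<otimes> a" "y \<otimes> a" a a] by (simp add: arr_def)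
      then show "c *s f \<in> Hom (ind_cat C A) u v"
        using arr_scale[OF f(1), of c] arr_comp_scale_left[OF act(1) f(1), of c]
          arr_comp_scale_right[OF arr_tens[OF f(1) id(1)] act(2), of c] f(2) x y
        by (simp add: Hom_ind_iff)
    qed
  qed
  show "Ident (ind_cat C A) u \<in> Hom (ind_cat C A) u u" if u: "u \<in> Obj (ind_cat C A)" for u
  proof -
    obtain x where x: "x \<in> Obj C" "u = Ind C A x" using u by (auto simp: Obj_ind)
    show ?thesis
      using arr_ident[OF tens_obj[OF x(1) a_obj]] arr_ident_left[OF arr_act[OF x(1)]]
        arr_ident_right[OF arr_act[OF x(1)]] x
      by (simp add: Hom_ind_iff Ident_ind tens_ident tens_obj a_obj)
  qed
  show "g \<cdot>\<^bsub>ind_cat C A\<^esub> f \<in> Hom (ind_cat C A) u w"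
    if uvw: "u \<in> Obj (ind_cat C A)" "v \<in> Obj (ind_cat C A)" "w \<in> Obj (ind_cat C A)"
      and fg: "f \<in> Hom (ind_cat C A) u v" "g \<in> Hom (ind_cat C A) v w" for u v w f g
  proof -
    obtain x y z where x: "x \<in> Obj C" "u = Ind C A x" and y: "y \<in> Obj C" "v = Ind C A y"
      and z: "z \<in> Obj C" "w = Ind C A z"
      using uvw by (auto simp: Obj_ind)
    have f: "arr f (x \<otimes> a) (y \<otimes> a)" "f \<cdot> act x = act y \<cdot> (f \<boxtimes> Ident C a)"
      and g: "arr g (y \<otimes> a) (z \<otimes> a)" "g \<cdot> act y = act z \<cdot> (g \<boxtimes> Ident C a)"
      using fg x y z by (simp_all add: Hom_ind_iff)
    note fi = arr_tens[OF f(1) id(1)] and gi = arr_tens[OF g(1) id(1)]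
    have "(g \<cdot> f) \<cdot> act x = (g \<cdot> act y) \<cdot> (f \<boxtimes> Ident C a)"
      using arr_assoc[OF arr_act[OF x(1)] f(1) g(1)] f(2) arr_assoc[OF fi arr_act[OF y(1)] g(1)]
      by simp
    also have "\<dots> = act z \<cdot> ((g \<cdot> f) \<boxtimes> Ident C a)"
      using g(2) arr_assoc[OF fi gi arr_act[OF z(1)]] arr_tens_comp[OF f(1) g(1) id(1) id(1)] id(2)
      by simp
    finally show ?thesis using arr_comp[OF f(1) g(1)] x z by (simp add: Hom_ind_iff)
  qed
qed (unfold Comp_ind; (auto simp: Obj_ind Hom_ind_iff Ident_ind arr_ident_left arr_ident_right
   intro: arr_assoc arr_comp_add_right arr_comp_add_left arr_comp_scale_left arr_comp_scale_right; fail))+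

lemma ind_arr_iff:
  "\<lbrakk>x \<in> Obj C; y \<in> Obj C\<rbrakk> \<Longrightarrow>
    ind.arr f (Ind C A x) (Ind C A y) \<longleftrightarrow> f \<in> Hom (ind_cat C A) (Ind C A x) (Ind C A y)"
  by (simp add: ind.arr_def Obj_ind)

lemma ind_arr: "\<lbrakk>ind.arr f (Ind C A x) (Ind C A y); x \<in> Obj C; y \<in> Obj C\<rbrakk>
    \<Longrightarrow> arr f (x \<otimes> a) (y \<otimes> a)"
  by (simp add: ind_arr_iff Hom_ind_iff)

text \<open>
  Since every \<open>mc j l\<close> is split epi, each single component \<open>x \<otimes> L j\<close> generates \<open>Ind x\<close> as a
  module.
\<close>

lemma ind_arr_vanish:
  assumes x: "x \<in> Obj C" and y: "y \<in> Obj C" and f: "ind.arr f (Ind C A x) (Ind C A y)"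
    and vanish: "f \<cdot> E x j = 0"
  shows "f = 0"
proof (rule biproduct_eqI[OF Ind_biproduct[OF x]])
  show f': "arr f (x \<otimes> a) (y \<otimes> a)" by (rule ind_arr[OF f x y])
  show "arr 0 (x \<otimes> a) (y \<otimes> a)" using x y by (simp add: arr_zero tens_obj a_obj)
  fix k
  \<comment> \<open>Acting in degree k - j carries component j to component k. Hence
    \<open>f \<cdot> E x k \<cdot> n\<close> is the action of \<open>Ind C A y\<close> after
    \<open>(f \<cdot> E x j) \<boxtimes> emb (k - j)\<close>, which is zero, and r removes the split
    epimorphism n.\<close>
  obtain n r where n: "arr n ((x \<otimes> L j) \<otimes> L (k - j)) (x \<otimes> L k)"
    "arr r (x \<otimes> L k) ((x \<otimes> L j) \<otimes> L (k - j))"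
    "act x \<cdot> (E x j \<boxtimes> emb (k - j)) = E x k \<cdot> n" "n \<cdot> r = Ident C (x \<otimes> L k)"
    using act_E[OF x, of j "k - j"] by (auto simp: algebra_simps)
  note Ek = arr_E[OF x, of k] and id = arr_ident[OF a_obj]
  have Ee: "arr (E x j \<boxtimes> emb (k - j)) ((x \<otimes> L j) \<otimes> L (k - j)) ((x \<otimes> a) \<otimes> a)"
    by (intro arr_tens[OF arr_E[OF x]] arr_emb)
  have "f \<cdot> E x k \<cdot> n = (f \<cdot> act x) \<cdot> (E x j \<boxtimes> emb (k - j))"
    using arr_assoc[OF Ee arr_act[OF x] f'] n(3) by simp
  also have "\<dots> = act y \<cdot> (f \<boxtimes> Ident C a) \<cdot> (E x j \<boxtimes> emb (k - j))"
    using f x y arr_assoc[OF Ee arr_tens[OF f' id] arr_act[OF y]]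
    by (simp add: ind_arr_iff Hom_ind_iff)
  also have "(f \<boxtimes> Ident C a) \<cdot> (E x j \<boxtimes> emb (k - j)) = (f \<cdot> E x j) \<boxtimes> emb (k - j)"
    using arr_tens_comp[OF arr_E[OF x, of j] f' arr_emb[of "k - j"] id] arr_ident_left[OF arr_emb]
    by simp
  also have "\<dots> = 0"
    using vanish tens_zero_left[OF _ _ arr_emb, of "x \<otimes> L j" "y \<otimes> a"] x y
    by (simp add: tens_obj a_obj L_obj)
  also have "act y \<cdot> 0 = 0"
    by (rule comp_zero_right[OF arr_act[OF y]]) (rule tens_obj[OF tens_obj[OF x L_obj[of j]] L_obj])
  finally have "(f \<cdot> E x k \<cdot> n) \<cdot> r = 0"
    using comp_zero_left[OF n(2), of "y \<otimes> a"] y by (simp add: tens_obj a_obj)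
  moreover have "(f \<cdot> E x k \<cdot> n) \<cdot> r = f \<cdot> E x k"
    using arr_assoc[OF n(2) arr_comp[OF n(1) Ek] f'] arr_assoc[OF n(2,1) Ek] n(4)
      arr_ident_right[OF Ek] by simp
  ultimately show "f \<cdot> E x k = 0 \<cdot> E x k"
    using comp_zero_left[OF Ek, of "y \<otimes> a"] y by (simp add: tens_obj a_obj)
qed

text \<open>If \<open>h \<cdot> f = 0\<close>, then \<open>h \<cdot> E y k\<close> kills the
  epimorphism g, so h vanishes on one component and is zero. The test objects of ind-A are
  themselves induced modules, so \<open>ind_arr_vanish\<close> covers every h.\<close>

lemma ind_epiI:
  assumes x: "x \<in> Obj C" and y: "y \<in> Obj C" and f: "ind.arr f (Ind C A x) (Ind C A y)"
    and g: "is_epi C (x \<otimes> L j) (y \<otimes> L k) g" and fg: "f \<cdot> E x j = E y k \<cdot> g"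
  shows "is_epi (ind_cat C A) (Ind C A x) (Ind C A y) f"
proof (rule ind.is_epiI[OF f])
  fix z h assume h: "ind.arr h (Ind C A y) z" and hf: "h \<cdot>\<^bsub>ind_cat C A\<^esub> f = 0"
  obtain w where w: "w \<in> Obj C" "z = Ind C A w" using h by (auto simp: ind.arr_def Obj_ind)
  have h': "arr h (y \<otimes> a) (w \<otimes> a)" using h w y ind_arr by simp
  have g': "arr g (x \<otimes> L j) (y \<otimes> L k)" using g by (simp add: is_epi_def arr_def)
  have "(h \<cdot> E y k) \<cdot> g = (h \<cdot> f) \<cdot> E x j"
    using arr_assoc[OF g' arr_E[OF y] h'] arr_assoc[OF arr_E[OF x] ind_arr[OF f x y] h'] fg by simp
  also have "\<dots> = 0" using hf comp_zero_left[OF arr_E[OF x], of "w \<otimes> a"] w(1) by (simp add: tens_obj a_obj)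
  finally have "h \<cdot> E y k = 0"
    using is_epi_cancel[OF g arr_comp[OF arr_E[OF y] h']] by simp
  then show "h = 0" using ind_arr_vanish[OF y w(1)] h w(2) by simp
qed

text \<open>Functoriality of Ind, by naturality of the associator and interchange. The second
  identity says that the induced map has degree 0 and exposes its component at \<open>L j\<close>,
  to which \<open>ind_epiI\<close> is applied.\<close>

lemma Ind_map:
  assumes c: "arr c y q"
  shows "ind.arr (c \<boxtimes> Ident C a) (Ind C A y) (Ind C A q)"
    and "(c \<boxtimes> Ident C a) \<cdot> E y j = E q j \<cdot> (c \<boxtimes> Ident C (L j))"
proof -
  have yq: "y \<in> Obj C" "q \<in> Obj C" using c by (auto simp: arr_def)
  note id = arr_ident[OF a_obj] and idy = arr_ident[OF yq(1)] and idq = arr_ident[OF yq(2)]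
    and idL = arr_ident[OF L_obj]
  have idaa: "Ident C a \<boxtimes> Ident C a = Ident C (a \<otimes> a)" by (rule tens_ident[OF a_obj a_obj])
  note cc = arr_tens[OF arr_tens[OF c id] id]
  have caa: "arr (c \<boxtimes> Ident C (a \<otimes> a)) (y \<otimes> (a \<otimes> a)) (q \<otimes> (a \<otimes> a))"
    using arr_tens[OF c arr_tens[OF id id]] idaa by simp
  have ym: "arr (Ident C y \<boxtimes> alg_mult A) (y \<otimes> (a \<otimes> a)) (y \<otimes> a)"
    and qm: "arr (Ident C q \<boxtimes> alg_mult A) (q \<otimes> (a \<otimes> a)) (q \<otimes> a)"
    by (rule arr_tens[OF idy arr_mult] arr_tens[OF idq arr_mult])+
  have "(c \<boxtimes> Ident C a) \<cdot> (Ident C y \<boxtimes> alg_mult A) = c \<boxtimes> alg_mult A"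
    using arr_tens_comp[OF idy c arr_mult id] arr_ident_right[OF c] arr_ident_left[OF arr_mult] by simp
  also have "\<dots> = (Ident C q \<boxtimes> alg_mult A) \<cdot> (c \<boxtimes> Ident C (a \<otimes> a))"
    using arr_tens_comp[OF c idq arr_ident arr_mult] arr_ident_left[OF c] arr_ident_right[OF arr_mult]
    by (simp add: tens_obj a_obj)
  finally have "(c \<boxtimes> Ident C a) \<cdot> act y
      = (Ident C q \<boxtimes> alg_mult A) \<cdot> (c \<boxtimes> Ident C (a \<otimes> a)) \<cdot> Assoc C y a a"
    using arr_assoc[OF arr_Assoc[OF yq(1) a_obj a_obj] ym arr_tens[OF c id]]
      arr_assoc[OF arr_Assoc[OF yq(1) a_obj a_obj] caa qm] by simp
  also have "\<dots> = act q \<cdot> ((c \<boxtimes> Ident C a) \<boxtimes> Ident C a)"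
    using arr_assoc_natural[OF c id id] idaa arr_assoc[OF cc arr_Assoc[OF yq(2) a_obj a_obj] qm]
    by simp
  finally show "ind.arr (c \<boxtimes> Ident C a) (Ind C A y) (Ind C A q)"
    using yq arr_tens[OF c id] by (simp add: ind_arr_iff Hom_ind_iff)
  show "(c \<boxtimes> Ident C a) \<cdot> E y j = E q j \<cdot> (c \<boxtimes> Ident C (L j))"
    using arr_tens_comp[OF idy c arr_emb[of j] id] arr_tens_comp[OF c idq idL arr_emb[of j]]
      arr_ident_right[OF c] arr_ident_left[OF c] arr_ident_left[OF arr_emb[of j]]
      arr_ident_right[OF arr_emb[of j]] by simp
qed

text \<open>\<open>r y\<close> composes the right unitor with a fixed isomorphism from
  \<open>L 0\<close> to the unit and is natural because both ingredients are. It relates a morphism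
  c of C to the degree-0 component of the map it induces.\<close>

lemma right_unitor_L0:
  obtains r where "\<And>y. y \<in> Obj C \<Longrightarrow> is_iso C (y \<otimes> L 0) y (r y)"
    and "\<And>c y q. arr c y q \<Longrightarrow> r q \<cdot> (c \<boxtimes> Ident C (L 0)) = c \<cdot> r y"
proof -
  obtain v where v: "is_iso C (L 0) \<one> v" using L_zero unfolding isomorphic_def by blast
  then have v': "arr v (L 0) \<one>" by (simp add: is_iso_def arr_def)
  have R: "arr (RUnit C y) (y \<otimes> \<one>) y" if "y \<in> Obj C" for y
    using runit_iso[OF that] by (simp add: is_iso_def arr_def)
  show thesis
  proof (rule that[of "\<lambda>y. RUnit C y \<cdot> (Ident C y \<boxtimes> v)"])
    show "is_iso C (y \<otimes> L 0) y (RUnit C y \<cdot> (Ident C y \<boxtimes> v))" if "y \<in> Obj C" for y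
      by (rule is_iso_comp[OF is_iso_tens_left[OF that v] runit_iso[OF that]])
    fix c y q assume c: "arr c y q"
    then have yq: "y \<in> Obj C" "q \<in> Obj C" by (auto simp: arr_def)
    note idy = arr_ident[OF yq(1)] and idq = arr_ident[OF yq(2)] and id1 = arr_ident[OF unit_obj]
      and idL = arr_ident[OF L_obj[of 0]]
    have "(RUnit C q \<cdot> (Ident C q \<boxtimes> v)) \<cdot> (c \<boxtimes> Ident C (L 0)) = RUnit C q \<cdot> (c \<boxtimes> v)"
      using arr_assoc[OF arr_tens[OF c idL] arr_tens[OF idq v'] R[OF yq(2)]]
        arr_tens_comp[OF c idq idL v'] arr_ident_left[OF c] arr_ident_right[OF v'] by simp
    also have "c \<boxtimes> v = (c \<boxtimes> Ident C \<one>) \<cdot> (Ident C y \<boxtimes> v)"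
      using arr_tens_comp[OF idy c v' id1] arr_ident_right[OF c] arr_ident_left[OF v'] by simp
    also have "RUnit C q \<cdot> \<dots> = c \<cdot> RUnit C y \<cdot> (Ident C y \<boxtimes> v)"
      using arr_assoc[OF arr_tens[OF idy v'] arr_tens[OF c id1] R[OF yq(2)]]
        arr_assoc[OF arr_tens[OF idy v'] R[OF yq(1)] c] runit_natural[of y q c] c
      by (simp add: arr_def)
    finally show "(RUnit C q \<cdot> (Ident C q \<boxtimes> v)) \<cdot> (c \<boxtimes> Ident C (L 0)) =
      c \<cdot> RUnit C y \<cdot> (Ident C y \<boxtimes> v)" .
  qed
qed

text \<open>Factoring through a component amounts to being fixed by its idempotent. In this form a
  degree is a commutation rule, so composites and inverses can be handled without choosing
  factorisations.\<close>

lemma hom_degree_iff: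
  assumes x: "x \<in> Obj C" and y: "y \<in> Obj C"
  shows "f \<in> hom_degree C A L emb x y i \<longleftrightarrow>
    ind.arr f (Ind C A x) (Ind C A y) \<and> (\<forall>j. P y (i + j) \<cdot> f = f \<cdot> P x j)"
proof (cases "ind.arr f (Ind C A x) (Ind C A y)")
  case True
  then have f: "arr f (x \<otimes> a) (y \<otimes> a)" using x y by (rule ind_arr)
  note Ex = arr_E[OF x] and Ey = arr_E[OF y] and Px = arr_P[OF x] and Py = arr_P[OF y]
  have "(\<exists>g\<in>Hom C (x \<otimes> L j) (y \<otimes> L (i + j)). f \<cdot> E x j = E y (i + j) \<cdot> g) \<longleftrightarrow>
    P y (i + j) \<cdot> f \<cdot> E x j = f \<cdot> E x j" for j
  proof
    assume "\<exists>g\<in>Hom C (x \<otimes> L j) (y \<otimes> L (i + j)). f \<cdot> E x j = E y (i + j) \<cdot> g"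
    then obtain g where "arr g (x \<otimes> L j) (y \<otimes> L (i + j))" "f \<cdot> E x j = E y (i + j) \<cdot> g"
      using x y by (auto simp: arr_def tens_obj L_obj)
    then show "P y (i + j) \<cdot> f \<cdot> E x j = f \<cdot> E x j"
      using arr_assoc[of g _ _ _ _ "P y (i + j)", OF _ Ey Py] P_E[OF y] by metis
  next
    assume eq: "P y (i + j) \<cdot> f \<cdot> E x j = f \<cdot> E x j"
    have Q: "arr (Ident C y \<boxtimes> prj (i + j)) (y \<otimes> a) (y \<otimes> L (i + j))"
      using biproduct_prj[OF Ind_biproduct[OF y]] by simp
    have fE: "arr (f \<cdot> E x j) (x \<otimes> L j) (y \<otimes> a)" by (rule arr_comp[OF Ex f])
    show "\<exists>g\<in>Hom C (x \<otimes> L j) (y \<otimes> L (i + j)). f \<cdot> E x j = E y (i + j) \<cdot> g"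
      using eq arr_assoc[OF fE Q Ey] arr_comp[OF fE Q] unfolding arr_def by metis
  qed
  moreover have "(\<forall>j. P y (i + j) \<cdot> f \<cdot> E x j = f \<cdot> E x j) \<longleftrightarrow> (\<forall>j. P y (i + j) \<cdot> f = f \<cdot> P x j)"
  proof (intro iffI allI)
    fix j assume *: "\<forall>j. P y (i + j) \<cdot> f \<cdot> E x j = f \<cdot> E x j"
    show "P y (i + j) \<cdot> f = f \<cdot> P x j"
    proof (rule biproduct_eqI[OF Ind_biproduct[OF x] arr_comp[OF f Py] arr_comp[OF Px f]])
      fix k
      have fE: "arr (f \<cdot> E x k) (x \<otimes> L k) (y \<otimes> a)" by (rule arr_comp[OF Ex f])
      have Q: "arr (Ident C y \<boxtimes> prj (i + k)) (y \<otimes> a) (y \<otimes> L (i + k))"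
        using biproduct_prj[OF Ind_biproduct[OF y]] by simp
      \<comment> \<open>f maps component k into component i + k, so \<open>P y (i + j)\<close> kills
        \<open>f \<cdot> E x k\<close> unless j = k; on the other side \<open>P x j\<close> kills
        \<open>E x k\<close> in the same cases.\<close>
      have h: "arr ((Ident C y \<boxtimes> prj (i + k)) \<cdot> f \<cdot> E x k) (x \<otimes> L k) (y \<otimes> L (i + k))"
        and fEk: "f \<cdot> E x k = E y (i + k) \<cdot> (Ident C y \<boxtimes> prj (i + k)) \<cdot> f \<cdot> E x k"
        using arr_comp[OF fE Q] arr_assoc[OF fE Q Ey] spec[OF *, of k] by simp_all
      have "(P y (i + j) \<cdot> f) \<cdot> E x k = P y (i + j) \<cdot> f \<cdot> E x k"
        by (rule arr_assoc[OF Ex f Py])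
      also have "\<dots> = (if j = k then f \<cdot> E x k else 0)"
        using arr_assoc[OF h Ey Py, of "i + j"] fEk P_E[OF y, of "i + j" "i + k"]
          comp_zero_left[OF h, of "y \<otimes> a"] y by (auto simp: tens_obj a_obj)
      also have "\<dots> = f \<cdot> P x j \<cdot> E x k"
        using P_E[OF x, of j k] comp_zero_right[OF f, of "x \<otimes> L k"] x by (simp add: tens_obj L_obj)
      also have "\<dots> = (f \<cdot> P x j) \<cdot> E x k" by (rule arr_assoc[OF Ex Px f, symmetric])
      finally show "(P y (i + j) \<cdot> f) \<cdot> E x k = (f \<cdot> P x j) \<cdot> E x k" .
    qed
  next
    fix j assume "\<forall>j. P y (i + j) \<cdot> f = f \<cdot> P x j"
    then show "P y (i + j) \<cdot> f \<cdot> E x j = f \<cdot> E x j"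
      using arr_assoc[OF Ex f Py] arr_assoc[OF Ex Px f] P_E[OF x, of j j] by metis
  qed
  ultimately show ?thesis using True x y by (simp add: hom_degree_def ind_arr_iff)
qed (use x y in \<open>simp add: hom_degree_def ind_arr_iff\<close>)

section \<open>Homogeneous morphisms between simple induced modules\<close>

lemma homogeneous_iso:
  assumes x: "x \<in> Obj C" and sx: "quotient_simple (ind_cat C A) (Ind C A x)"
    and y: "y \<in> Obj C" and sy: "quotient_simple (ind_cat C A) (Ind C A y)"
    and f: "f \<in> hom_degree C A L emb x y i" and nz: "f \<noteq> 0"
  shows "is_iso (ind_cat C A) (Ind C A x) (Ind C A y) f"
proof -
  have fi: "ind.arr f (Ind C A x) (Ind C A y)" using f hom_degree_iff[OF x y] by blast
  note f' = ind_arr[OF fi x y]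
  obtain g where "g \<in> Hom C (x \<otimes> L (- i)) (y \<otimes> L (i + - i))"
    "f \<cdot> E x (- i) = E y (i + - i) \<cdot> g"
    using f unfolding hom_degree_def by blast
  then have g: "arr g (x \<otimes> L (- i)) (y \<otimes> L 0)" and fg: "f \<cdot> E x (- i) = E y 0 \<cdot> g"
    using x y by (simp_all add: arr_def tens_obj L_obj)
  obtain r where r: "\<And>y. y \<in> Obj C \<Longrightarrow> is_iso C (y \<otimes> L 0) y (r y)"
    and r_natural: "\<And>c y q. arr c y q \<Longrightarrow> r q \<cdot> (c \<boxtimes> Ident C (L 0)) = c \<cdot> r y"
    by (rule right_unitor_L0) (rule that)
  have r': "arr (r y) (y \<otimes> L 0) y" if "y \<in> Obj C" for y
    using r[OF that] by (simp add: is_iso_def arr_def)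
  have rg: "arr (r y \<cdot> g) (x \<otimes> L (- i)) y" by (rule arr_comp[OF g r'[OF y]])
  obtain q c where coker: "is_cokernel C (x \<otimes> L (- i)) y (r y \<cdot> g) q c"
    using ex_cokernel[of "x \<otimes> L (- i)" y "r y \<cdot> g"] rg by (auto simp: arr_def)
  have q: "q \<in> Obj C" and c: "arr c y q" and c_zero: "c \<cdot> r y \<cdot> g = 0"
    using coker y by (auto simp: is_cokernel_def arr_def)
  have cL: "arr (c \<boxtimes> Ident C (L 0)) (y \<otimes> L 0) (q \<otimes> L 0)"
    by (rule arr_tens[OF c arr_ident[OF L_obj]])
  let ?e = "c \<boxtimes> Ident C a"
  note e = Ind_map(1)[OF c] and eE = Ind_map(2)[OF c]
  note e' = ind_arr[OF e y q]
  \<comment> \<open>A cokernel is epi in C; the natural isomorphism r carries this to the degree-0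
    component of \<open>?e\<close>, and one epi component suffices in ind-A.\<close>
  have "is_epi C (y \<otimes> L 0) (q \<otimes> L 0) (c \<boxtimes> Ident C (L 0))"
    by (rule epi_transfer[OF is_cokernel_epi[OF coker rg] r[OF y] r[OF q] cL r_natural[OF c]])
  then have "is_epi (ind_cat C A) (Ind C A y) (Ind C A q) ?e"
    by (rule ind_epiI[OF y q e _ eE])
  then consider "?e = 0" | "is_iso (ind_cat C A) (Ind C A y) (Ind C A q) ?e"
    using ind.quotient_simple_epi[OF sy] by blast
  then have "c = 0"
  proof cases
    \<comment> \<open>Projecting to degree 0 gives \<open>c \<boxtimes> Ident C (L 0) = 0\<close>;
      naturality of r and invertibility of \<open>r y\<close> give back c = 0.\<close>
    case 1
    have "E q 0 \<cdot> (c \<boxtimes> Ident C (L 0)) = 0"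
      using eE[of 0] 1 comp_zero_left[OF arr_E[OF y, of 0], of "q \<otimes> a"] q
      by (simp add: tens_obj a_obj)
    moreover have p: "arr (Ident C q \<boxtimes> prj 0) (q \<otimes> a) (q \<otimes> L 0)"
      "(Ident C q \<boxtimes> prj 0) \<cdot> E q 0 = Ident C (q \<otimes> L 0)"
      using Ind_biproduct[OF q] by (simp_all add: is_biproduct_def arr_def)
    ultimately have "c \<boxtimes> Ident C (L 0) = 0"
      using arr_assoc[OF cL arr_E[OF q] p(1)] arr_ident_left[OF cL]
        comp_zero_right[OF p(1), of "y \<otimes> L 0"] y by (simp add: tens_obj L_obj)
    then have cr: "c \<cdot> r y = 0"
      using r_natural[OF c] comp_zero_right[OF r'[OF q], of "y \<otimes> L 0"] y by (simp add: tens_obj L_obj)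
    obtain s where s: "arr s y (y \<otimes> L 0)" "r y \<cdot> s = Ident C y"
      using r[OF y] by (rule is_iso_obtain)
    then show "c = 0"
      using arr_assoc[OF s(1) r'[OF y] c] cr arr_ident_right[OF c] comp_zero_left[OF s(1) q] by simp
  next
    case 2
    obtain t where t: "arr t q (q \<otimes> L 0)" "t \<cdot> r q = Ident C (q \<otimes> L 0)"
      using r[OF q] by (rule is_iso_obtain)
    have cg: "arr ((c \<boxtimes> Ident C (L 0)) \<cdot> g) (x \<otimes> L (- i)) (q \<otimes> L 0)" by (rule arr_comp[OF g cL])
    \<comment> \<open>Cancelling \<open>r q\<close> moves the relation
      \<open>c \<cdot> r y \<cdot> g = 0\<close> from q to the component
      \<open>q \<otimes> L 0\<close>, where it meets \<open>?e \<cdot> f\<close>.\<close>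
    have "r q \<cdot> (c \<boxtimes> Ident C (L 0)) \<cdot> g = 0"
      using arr_assoc[OF g cL r'[OF q]] r_natural[OF c] arr_assoc[OF g r'[OF y] c] c_zero by simp
    then have cg0: "(c \<boxtimes> Ident C (L 0)) \<cdot> g = 0"
      using arr_assoc[OF cg r'[OF q] t(1)] t(2) arr_ident_left[OF cg]
        comp_zero_right[OF t(1), of "x \<otimes> L (- i)"] x by (simp add: tens_obj L_obj)
    have "(?e \<cdot> f) \<cdot> E x (- i) = ?e \<cdot> E y 0 \<cdot> g"
      using arr_assoc[OF arr_E[OF x] f' e'] fg by simp
    also have "\<dots> = E q 0 \<cdot> (c \<boxtimes> Ident C (L 0)) \<cdot> g"
      using arr_assoc[OF g arr_E[OF y] e'] arr_assoc[OF g cL arr_E[OF q]] eE by simp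
    also have "\<dots> = 0"
      using cg0 comp_zero_right[OF arr_E[OF q], of "x \<otimes> L (- i)"] x by (simp add: tens_obj L_obj)
    finally have ef: "?e \<cdot> f = 0"
      using ind_arr_vanish[OF x q] ind.arr_comp[OF fi e] by simp
    obtain e'' where "ind.arr e'' (Ind C A q) (Ind C A y)"
      "e'' \<cdot>\<^bsub>ind_cat C A\<^esub> ?e = Ident (ind_cat C A) (Ind C A y)"
      using 2 by (rule ind.is_iso_obtain)
    then have "f = 0"
      using ind.arr_assoc[OF fi e] ind.arr_ident_left[OF fi] ef
        ind.comp_zero_right[of e'' _ _ "Ind C A x"] x by (metis Comp_ind Obj_ind imageI)
    with nz show ?thesis by simp
  qed
  then have "is_epi C (x \<otimes> L (- i)) y (r y \<cdot> g)"
    using epi_if_cokernel_zero[OF _ rg] coker by simp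
  \<comment> \<open>The transfer that follows keeps the source and strips \<open>r y\<close> from
    the target, so the identity serves as the source side of its square.\<close>
  moreover have "is_iso C (x \<otimes> L (- i)) (x \<otimes> L (- i)) (Ident C (x \<otimes> L (- i)))"
    by (rule is_isoI) (use arr_ident[of "x \<otimes> L (- i)"] arr_ident_left x in \<open>auto simp: tens_obj L_obj\<close>)
  ultimately have "is_epi C (x \<otimes> L (- i)) (y \<otimes> L 0) g"
    by (rule epi_transfer[OF _ _ r[OF y] g]) (rule arr_ident_right[OF rg, symmetric])
  then have "is_epi (ind_cat C A) (Ind C A x) (Ind C A y) f"
    by (rule ind_epiI[OF x y fi _ fg])
  then show ?thesis using ind.quotient_simple_epi[OF sx] nz by blast
qed

text \<open>Acting in degree l sends component k into component k + l, so the idempotent of degree j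
  + l selects after the action what the idempotent of degree j selects before it. This shift rule
  stands in for compatibility of the idempotents with the action.\<close>

lemma P_act:
  assumes y: "y \<in> Obj C"
  shows "P y (j + l) \<cdot> act y \<cdot> (Ident C (y \<otimes> a) \<boxtimes> emb l) = act y \<cdot> (P y j \<boxtimes> emb l)"
proof -
  have ya: "y \<otimes> a \<in> Obj C" by (rule tens_obj[OF y a_obj])
  note Py = arr_P[OF y] and Ey = arr_E[OF y] and id = arr_ident[OF ya] and idL = arr_ident[OF L_obj[of l]]
    and Pe = arr_tens[OF arr_P[OF y] arr_emb] and act = arr_act[OF y]
  note ide = arr_tens[OF id arr_emb[of l]]
  show ?thesis
  proof (rule biproduct_eqI[OF biproduct_tens_right[OF L_obj[of l] Ind_biproduct[OF y]]
        arr_comp[OF arr_comp[OF ide act] Py] arr_comp[OF Pe act]])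
    fix k
    note EL = arr_tens[OF Ey[of k] idL]
    obtain n where n: "arr n ((y \<otimes> L k) \<otimes> L l) (y \<otimes> L (k + l))"
      "act y \<cdot> (E y k \<boxtimes> emb l) = E y (k + l) \<cdot> n"
      using act_E[OF y, of k l] by blast
    have yk: "(y \<otimes> L k) \<otimes> L l \<in> Obj C" using y by (simp add: tens_obj L_obj)
    have "(P y (j + l) \<cdot> act y \<cdot> (Ident C (y \<otimes> a) \<boxtimes> emb l)) \<cdot> (E y k \<boxtimes> Ident C (L l))
        = P y (j + l) \<cdot> act y \<cdot> (E y k \<boxtimes> emb l)"
      using arr_assoc[OF EL arr_comp[OF ide act] Py] arr_assoc[OF EL ide act]
        arr_tens_comp[OF Ey[of k] id idL arr_emb] arr_ident_left[OF Ey] arr_ident_right[OF arr_emb]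
      by simp
    also have "\<dots> = (if j = k then act y \<cdot> (E y k \<boxtimes> emb l) else 0)"
      using n arr_assoc[OF n(1) Ey Py, of "j + l"] P_E[OF y, of "j + l" "k + l"]
        comp_zero_left[OF n(1) ya] by auto
    also have "\<dots> = act y \<cdot> ((P y j \<cdot> E y k) \<boxtimes> emb l)"
      using P_E[OF y, of j k] comp_zero_right[OF act yk]
        tens_zero_left[OF _ ya arr_emb, of "y \<otimes> L k" l] y by (auto simp: tens_obj L_obj)
    also have "\<dots> = (act y \<cdot> (P y j \<boxtimes> emb l)) \<cdot> (E y k \<boxtimes> Ident C (L l))"
      using arr_assoc[OF EL Pe act] arr_tens_comp[OF Ey[of k] Py idL arr_emb]
        arr_ident_right[OF arr_emb] by simp
    finally show "(P y (j + l) \<cdot> act y \<cdot> (Ident C (y \<otimes> a) \<boxtimes> emb l)) \<cdot> (E y k \<boxtimes> Ident C (L l)) =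
      (act y \<cdot> (P y j \<boxtimes> emb l)) \<cdot> (E y k \<boxtimes> Ident C (L l))" .
  qed
qed

lemma nonzero_homogeneous:
  assumes x: "x \<in> Obj C" and y: "y \<in> Obj C"
    and f: "ind.arr f (Ind C A x) (Ind C A y)" and nz: "f \<noteq> 0"
  obtains i h where "h \<in> hom_degree C A L emb x y i" "h \<noteq> 0"
proof -
  \<comment> \<open>The part of f of degree i: the sum of its blocks from component j to component i
    + j. A single block need not be a module morphism, since the action moves between
    components.\<close>
  define h where "h i = (\<Sum>j\<in>UNIV. P y (i + j) \<cdot> f \<cdot> P x j)" for i
  have xa: "x \<otimes> a \<in> Obj C" and ya: "y \<otimes> a \<in> Obj C" using x y by (simp_all add: tens_obj a_obj)
  note Py = arr_P[OF y] and Ey = arr_E[OF y] and Px = arr_P[OF x] and Ex = arr_E[OF x]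
    and f' = ind_arr[OF f x y] and idA = arr_ident[OF a_obj]
  have fP: "arr (f \<cdot> P x j) (x \<otimes> a) (y \<otimes> a)" for j by (rule arr_comp[OF Px f'])
  have PfP: "arr (P y i \<cdot> f \<cdot> P x j) (x \<otimes> a) (y \<otimes> a)" for i j by (rule arr_comp[OF fP Py])
  have fE: "arr (f \<cdot> E x j) (x \<otimes> L j) (y \<otimes> a)" for j by (rule arr_comp[OF Ex f'])
  have h: "arr (h i) (x \<otimes> a) (y \<otimes> a)" for i
    unfolding h_def by (rule arr_sum[OF xa ya PfP])
  have hE: "h i \<cdot> E x k = P y (i + k) \<cdot> f \<cdot> E x k" for i k
  proof -
    have "h i \<cdot> E x k = (\<Sum>j\<in>UNIV. (P y (i + j) \<cdot> f \<cdot> P x j) \<cdot> E x k)"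
      unfolding h_def by (rule comp_sum_left[OF Ex ya PfP])
    also have "\<dots> = (\<Sum>j\<in>UNIV. if j = k then P y (i + k) \<cdot> f \<cdot> E x k else 0)"
    proof (rule sum.cong)
      fix j
      have "(P y (i + j) \<cdot> f \<cdot> P x j) \<cdot> E x k = P y (i + j) \<cdot> f \<cdot> P x j \<cdot> E x k"
        using arr_assoc[OF Ex fP Py] arr_assoc[OF Ex Px f'] by simp
      then show "(P y (i + j) \<cdot> f \<cdot> P x j) \<cdot> E x k = (if j = k then P y (i + k) \<cdot> f \<cdot> E x k else 0)"
        using P_E[OF x, of j k] comp_zero_right[OF f', of "x \<otimes> L k"]
          comp_zero_right[OF Py, of "x \<otimes> L k"] x by (simp add: tens_obj L_obj)
    qed simp
    also have "\<dots> = P y (i + k) \<cdot> f \<cdot> E x k" by simp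
    finally show ?thesis .
  qed
  have hom: "ind.arr (h i) (Ind C A x) (Ind C A y)" for i
  proof -
    \<comment> \<open>Checked on \<open>(x \<otimes> L k) \<otimes> L l\<close>. After the action,
      \<open>h i\<close> contributes the idempotent of degree i + k + l; \<open>P_act\<close> moves
      it in front of the action with degree i + k, where it is \<open>h i\<close> on component
      k.\<close>
    have "h i \<cdot> act x = act y \<cdot> (h i \<boxtimes> Ident C a)"
    proof (rule biproduct_eqI[OF biproduct_tens_left[OF xa A_biproduct]
          arr_comp[OF arr_act[OF x] h] arr_comp[OF arr_tens[OF h idA] arr_act[OF y]]],
        rule biproduct_eqI[OF biproduct_tens_right[OF L_obj Ind_biproduct[OF x]]])
      fix l k
      note xe = arr_tens[OF arr_ident[OF xa] arr_emb[of l]]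
        and ye = arr_tens[OF arr_ident[OF ya] arr_emb[of l]]
        and EL = arr_tens[OF Ex[of k] arr_ident[OF L_obj[of l]]]
        and Ee = arr_tens[OF Ex[of k] arr_emb[of l]]
        and fEe = arr_tens[OF fE[of k] arr_ident[OF L_obj[of l]]]
      show "arr ((h i \<cdot> act x) \<cdot> (Ident C (x \<otimes> a) \<boxtimes> emb l)) ((x \<otimes> a) \<otimes> L l) (y \<otimes> a)"
        by (rule arr_comp[OF xe arr_comp[OF arr_act[OF x] h]])
      show "arr ((act y \<cdot> (h i \<boxtimes> Ident C a)) \<cdot> (Ident C (x \<otimes> a) \<boxtimes> emb l)) ((x \<otimes> a) \<otimes> L l) (y \<otimes> a)"
        by (rule arr_comp[OF xe arr_comp[OF arr_tens[OF h idA] arr_act[OF y]]])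
      have e: "(Ident C (x \<otimes> a) \<boxtimes> emb l) \<cdot> (E x k \<boxtimes> Ident C (L l)) = E x k \<boxtimes> emb l"
        using arr_tens_comp[OF Ex[of k] arr_ident[OF xa] arr_ident[OF L_obj[of l]] arr_emb[of l]]
          arr_ident_left[OF Ex] arr_ident_right[OF arr_emb] by simp
      have ind: "(u \<boxtimes> Ident C a) \<cdot> (E x k \<boxtimes> emb l) = (u \<cdot> E x k) \<boxtimes> emb l"
        if "arr u (x \<otimes> a) (y \<otimes> a)" for u
        using arr_tens_comp[OF Ex[of k] that arr_emb[of l] idA] arr_ident_left[OF arr_emb] by simp
      obtain n where n: "arr n ((x \<otimes> L k) \<otimes> L l) (x \<otimes> L (k + l))"
        "act x \<cdot> (E x k \<boxtimes> emb l) = E x (k + l) \<cdot> n"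
        using act_E[OF x, of k l] by blast
      have "((h i \<cdot> act x) \<cdot> (Ident C (x \<otimes> a) \<boxtimes> emb l)) \<cdot> (E x k \<boxtimes> Ident C (L l))
          = h i \<cdot> act x \<cdot> (E x k \<boxtimes> emb l)"
        using arr_assoc[OF EL xe arr_comp[OF arr_act[OF x] h]] e arr_assoc[OF Ee arr_act[OF x] h]
        by simp
      also have "\<dots> = (P y (i + (k + l)) \<cdot> f \<cdot> E x (k + l)) \<cdot> n"
        using n(2) arr_assoc[OF n(1) Ex h] hE by simp
      also have "\<dots> = P y (i + k + l) \<cdot> f \<cdot> act x \<cdot> (E x k \<boxtimes> emb l)"
        using arr_assoc[OF n(1) fE Py] arr_assoc[OF n(1) Ex f'] n(2) by (simp add: add.assoc)
      also have "f \<cdot> act x \<cdot> (E x k \<boxtimes> emb l) = act y \<cdot> ((f \<cdot> E x k) \<boxtimes> emb l)"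
        using f x y arr_assoc[OF Ee arr_act[OF x] f'] ind[OF f']
          arr_assoc[OF Ee arr_tens[OF f' idA] arr_act[OF y]]
        by (simp add: ind_arr_iff Hom_ind_iff)
      also have "(f \<cdot> E x k) \<boxtimes> emb l
          = (Ident C (y \<otimes> a) \<boxtimes> emb l) \<cdot> ((f \<cdot> E x k) \<boxtimes> Ident C (L l))"
        using arr_tens_comp[OF fE arr_ident[OF ya] arr_ident[OF L_obj] arr_emb]
          arr_ident_left[OF fE] arr_ident_right[OF arr_emb] by simp
      also have "P y (i + k + l) \<cdot> act y \<cdot> \<dots>
          = (P y (i + k + l) \<cdot> act y \<cdot> (Ident C (y \<otimes> a) \<boxtimes> emb l)) \<cdot> ((f \<cdot> E x k) \<boxtimes> Ident C (L l))"
        using arr_assoc[OF fEe ye arr_act[OF y]]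
          arr_assoc[OF fEe arr_comp[OF ye arr_act[OF y]] Py] by simp
      also have "\<dots> = act y \<cdot> ((P y (i + k) \<cdot> f \<cdot> E x k) \<boxtimes> emb l)"
        using P_act[OF y, of "i + k" l] arr_assoc[OF fEe arr_tens[OF Py arr_emb] arr_act[OF y]]
          arr_tens_comp[OF fE Py arr_ident[OF L_obj] arr_emb] arr_ident_right[OF arr_emb] by simp
      also have "\<dots> = act y \<cdot> (h i \<boxtimes> Ident C a) \<cdot> (E x k \<boxtimes> emb l)"
        using ind[OF h] hE by simp
      also have "\<dots> = ((act y \<cdot> (h i \<boxtimes> Ident C a)) \<cdot> (Ident C (x \<otimes> a) \<boxtimes> emb l))
          \<cdot> (E x k \<boxtimes> Ident C (L l))"
        using arr_assoc[OF EL xe arr_comp[OF arr_tens[OF h idA] arr_act[OF y]]] e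
          arr_assoc[OF Ee arr_tens[OF h idA] arr_act[OF y]] by simp
      finally show "((h i \<cdot> act x) \<cdot> (Ident C (x \<otimes> a) \<boxtimes> emb l)) \<cdot> (E x k \<boxtimes> Ident C (L l)) =
        ((act y \<cdot> (h i \<boxtimes> Ident C a)) \<cdot> (Ident C (x \<otimes> a) \<boxtimes> emb l)) \<cdot> (E x k \<boxtimes> Ident C (L l))" .
    qed
    then show ?thesis using h x y by (simp add: ind_arr_iff Hom_ind_iff)
  qed
  have "h i \<in> hom_degree C A L emb x y i" for i
    unfolding hom_degree_def
  proof (intro CollectI conjI allI)
    show "h i \<in> Hom (ind_cat C A) (Ind C A x) (Ind C A y)"
      using hom x y by (simp add: ind_arr_iff)
    fix j
    have Q: "arr (Ident C y \<boxtimes> prj (i + j)) (y \<otimes> a) (y \<otimes> L (i + j))"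
      using biproduct_prj[OF Ind_biproduct[OF y]] by simp
    show "\<exists>g\<in>Hom C (x \<otimes> L j) (y \<otimes> L (i + j)). h i \<cdot> E x j = E y (i + j) \<cdot> g"
      using arr_comp[OF fE[of j] Q] arr_assoc[OF fE[of j] Q Ey] hE[of i j] unfolding arr_def by auto
  qed
  \<comment> \<open>Every block \<open>P y i \<cdot> f \<cdot> E x k\<close> is the restriction of
    \<open>h (i - k)\<close> to component k, so f would have no non-zero block if all
    \<open>h i\<close> were zero.\<close>
  moreover have "\<exists>i. h i \<noteq> 0"
  proof (rule ccontr)
    assume "\<not> (\<exists>i. h i \<noteq> 0)"
    then have *: "P y i \<cdot> f \<cdot> E x k = 0" for i k
      using hE[of "i - k" k] comp_zero_left[OF Ex ya] by simp
    have "f \<cdot> E x k = 0 \<cdot> E x k" for k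
    proof -
      have "f \<cdot> E x k = (\<Sum>i\<in>UNIV. P y i) \<cdot> f \<cdot> E x k"
        using Ind_biproduct[OF y] arr_ident_left[OF fE] by (simp add: is_biproduct_def)
      also have "\<dots> = 0" using comp_sum_left[OF fE ya Py] * by simp
      finally show ?thesis using comp_zero_left[OF Ex ya] by simp
    qed
    then have "f = 0"
      using biproduct_eqI[OF Ind_biproduct[OF x] f' arr_zero[OF xa ya]] by blast
    with nz show False by simp
  qed
  ultimately show thesis using that by blast
qed

section \<open>Degrees of composites and inverses\<close>

lemma hom_degree_comp:
  assumes "x \<in> Obj C" "y \<in> Obj C" "z \<in> Obj C"
    and f: "f \<in> hom_degree C A L emb x y i" and g: "g \<in> hom_degree C A L emb y z j"
  shows "g \<cdot> f \<in> hom_degree C A L emb x z (i + j)"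
proof -
  note xyz = assms(1-3)
  have f: "ind.arr f (Ind C A x) (Ind C A y)" "\<And>k. P y (i + k) \<cdot> f = f \<cdot> P x k"
    and g: "ind.arr g (Ind C A y) (Ind C A z)" "\<And>k. P z (j + k) \<cdot> g = g \<cdot> P y k"
    using f g xyz hom_degree_iff by blast+
  note f' = ind_arr[OF f(1) xyz(1,2)] and g' = ind_arr[OF g(1) xyz(2,3)]
  note Px = arr_P[OF xyz(1)] and Py = arr_P[OF xyz(2)] and Pz = arr_P[OF xyz(3)]
  have "P z (i + j + k) \<cdot> g \<cdot> f = (g \<cdot> f) \<cdot> P x k" for k
  proof -
    \<comment> \<open>The idempotent passes g with shift j and then f with shift i; commutativity of
      the group reorders the index accordingly.\<close>
    have "P z (i + j + k) \<cdot> g \<cdot> f = (P z (j + (i + k)) \<cdot> g) \<cdot> f"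
      using arr_assoc[OF f' g' Pz] by (simp add: ac_simps)
    also have "\<dots> = (g \<cdot> f) \<cdot> P x k"
      using arr_assoc[OF f' Py g'] arr_assoc[OF Px f' g'] f(2) g(2) by simp
    finally show ?thesis .
  qed
  then show ?thesis
    using ind.arr_comp[OF f(1) g(1)] xyz by (simp add: hom_degree_iff)
qed

text \<open>Inserting \<open>g \<cdot> f\<close> before \<open>P x (- i + k) \<cdot> g\<close> and
  moving the idempotent through f leaves \<open>g \<cdot> P y k\<close>.\<close>

lemma hom_degree_inverse:
  assumes x: "x \<in> Obj C" and y: "y \<in> Obj C" and f: "f \<in> hom_degree C A L emb x y i"
    and g: "ind.arr g (Ind C A y) (Ind C A x)"
    and inv: "g \<cdot> f = Ident C (x \<otimes> a)" "f \<cdot> g = Ident C (y \<otimes> a)"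
  shows "g \<in> hom_degree C A L emb y x (- i)"
proof -
  have f: "ind.arr f (Ind C A x) (Ind C A y)" "\<And>k. P y (i + k) \<cdot> f = f \<cdot> P x k"
    using f x y hom_degree_iff by blast+
  note f' = ind_arr[OF f(1) x y] and g' = ind_arr[OF g y x]
  note Px = arr_P[OF x] and Py = arr_P[OF y]
  have "P x (- i + k) \<cdot> g = g \<cdot> P y k" for k
  proof -
    have Pg: "arr (P x (- i + k) \<cdot> g) (y \<otimes> a) (x \<otimes> a)" by (rule arr_comp[OF g' Px])
    have fP: "f \<cdot> P x (- i + k) = P y k \<cdot> f" using f(2)[of "- i + k"] by simp
    have "P x (- i + k) \<cdot> g = (g \<cdot> f) \<cdot> P x (- i + k) \<cdot> g"
      using inv(1) arr_ident_left[OF Pg] by simp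
    also have "\<dots> = g \<cdot> (f \<cdot> P x (- i + k)) \<cdot> g"
      using arr_assoc[OF Pg f' g'] arr_assoc[OF g' Px f'] by simp
    also have "\<dots> = g \<cdot> P y k"
      using fP arr_assoc[OF g' f' Py] inv(2) arr_ident_right[OF Py] by simp
    finally show ?thesis .
  qed
  then show ?thesis using g x y by (simp add: hom_degree_iff)
qed

section \<open>Comparison of the Hom space with both endomorphism spaces\<close>

lemma hom_zero_or_graded_isomorphic:
  assumes x: "x \<in> Obj C" and sx: "quotient_simple (ind_cat C A) (Ind C A x)"
    and y: "y \<in> Obj C" and sy: "quotient_simple (ind_cat C A) (Ind C A y)"
  shows "Hom (ind_cat C A) (Ind C A x) (Ind C A y) = {0} \<or>
    (\<exists>d. graded_isomorphic_by scale d
           (Hom (ind_cat C A) (Ind C A x) (Ind C A y)) (hom_degree C A L emb x y)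
           (Hom (ind_cat C A) (Ind C A x) (Ind C A x)) (hom_degree C A L emb x x) \<and>
         graded_isomorphic_by scale d
           (Hom (ind_cat C A) (Ind C A x) (Ind C A y)) (hom_degree C A L emb x y)
           (Hom (ind_cat C A) (Ind C A y) (Ind C A y)) (hom_degree C A L emb y y))"
proof (cases "\<exists>f. ind.arr f (Ind C A x) (Ind C A y) \<and> f \<noteq> 0")
  case False
  then show ?thesis
    using x y ind.arr_zero[of "Ind C A x" "Ind C A y"] by (auto simp: ind_arr_iff Obj_ind)
next
  case True
  then obtain f i where fi: "f \<in> hom_degree C A L emb x y i" and "f \<noteq> 0"
    using nonzero_homogeneous[OF x y] by metis
  then have "is_iso (ind_cat C A) (Ind C A x) (Ind C A y) f"
    by (intro homogeneous_iso[OF assms])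
  then obtain g where f: "ind.arr f (Ind C A x) (Ind C A y)" and g: "ind.arr g (Ind C A y) (Ind C A x)"
    and inv: "g \<cdot> f = Ident C (x \<otimes> a)" "f \<cdot> g = Ident C (y \<otimes> a)"
    by (rule ind.is_iso_obtain) (simp add: Ident_ind)
  have gi: "g \<in> hom_degree C A L emb y x (- i)" by (rule hom_degree_inverse[OF x y fi g inv])
  have X: "Ind C A x \<in> Obj (ind_cat C A)" and Y: "Ind C A y \<in> Obj (ind_cat C A)"
    using x y by (auto simp: Obj_ind)
  have arr_hom: "ind.arr u (Ind C A x) (Ind C A y)"
    if "u \<in> Hom (ind_cat C A) (Ind C A x) (Ind C A y)" for u
    using that x y by (simp add: ind_arr_iff)
  have arr_deg: "ind.arr u (Ind C A v) (Ind C A w)"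
    if "u \<in> hom_degree C A L emb v w j" "v \<in> Obj C" "w \<in> Obj C" for u v w j
    using that by (simp add: hom_degree_iff)
  have gfu: "g \<cdot> f \<cdot> u = u" if "ind.arr u (Ind C A x) (Ind C A x)" for u
    using ind.arr_assoc[OF that f g] ind.arr_ident_left[OF that] inv by (simp add: Ident_ind)
  have ufg: "(u \<cdot> f) \<cdot> g = u" if "ind.arr u (Ind C A y) (Ind C A y)" for u
    using ind.arr_assoc[OF g f that] ind.arr_ident_right[OF that] inv by (simp add: Ident_ind)
  have "graded_isomorphic_by scale (- i)
    (Hom (ind_cat C A) (Ind C A x) (Ind C A y)) (hom_degree C A L emb x y)
    (Hom (ind_cat C A) (Ind C A x) (Ind C A x)) (hom_degree C A L emb x x)"
    unfolding graded_isomorphic_by_def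
  \<comment> \<open>g leads back from \<open>Ind C A y\<close> to \<open>Ind C A x\<close> with
    degree - i, so applying it last shifts every degree by - i. Applying f last undoes this with
    shift i, so each graded piece is hit in full.\<close>
  proof (intro exI[of _ "(\<cdot>) g"] conjI ballI allI)
    show "bij_betw ((\<cdot>) g) (Hom (ind_cat C A) (Ind C A x) (Ind C A y))
        (Hom (ind_cat C A) (Ind C A x) (Ind C A x))"
      using ind.bij_betw_postcomp_iso[OF X g f] inv by (simp add: Ident_ind)
    show "g \<cdot> (u + v) = g \<cdot> u + g \<cdot> v"
      if "u \<in> Hom (ind_cat C A) (Ind C A x) (Ind C A y)"
        "v \<in> Hom (ind_cat C A) (Ind C A x) (Ind C A y)" for u v
      using ind.arr_comp_add_right[OF arr_hom[OF that(1)] arr_hom[OF that(2)] g] by simp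
    show "g \<cdot> c *s u = c *s (g \<cdot> u)"
      if "u \<in> Hom (ind_cat C A) (Ind C A x) (Ind C A y)" for c u
      using ind.arr_comp_scale_right[OF arr_hom[OF that] g] by simp
    show "(\<cdot>) g ` hom_degree C A L emb x y j = hom_degree C A L emb x x (j + - i)" for j
    proof (intro equalityI subsetI)
      fix u assume u: "u \<in> hom_degree C A L emb x x (j + - i)"
      then have "f \<cdot> u \<in> hom_degree C A L emb x y j"
        using hom_degree_comp[OF x x y u fi] by simp
      moreover have "u = g \<cdot> f \<cdot> u" using gfu[OF arr_deg[OF u x x]] by simp
      ultimately show "u \<in> (\<cdot>) g ` hom_degree C A L emb x y j" by blast
    qed (use hom_degree_comp[OF x y x _ gi] in blast)
  qed
  moreover have "graded_isomorphic_by scale (- i)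
    (Hom (ind_cat C A) (Ind C A x) (Ind C A y)) (hom_degree C A L emb x y)
    (Hom (ind_cat C A) (Ind C A y) (Ind C A y)) (hom_degree C A L emb y y)"
    unfolding graded_isomorphic_by_def
  \<comment> \<open>Here g is applied before u. The shift is again - i, so a single d serves both
    endomorphism spaces.\<close>
  proof (intro exI[of _ "\<lambda>u. u \<cdot> g"] conjI ballI allI)
    show "bij_betw (\<lambda>u. u \<cdot> g) (Hom (ind_cat C A) (Ind C A x) (Ind C A y))
        (Hom (ind_cat C A) (Ind C A y) (Ind C A y))"
      using ind.bij_betw_precomp_iso[OF Y g f] inv by (simp add: Ident_ind)
    show "(u + v) \<cdot> g = u \<cdot> g + v \<cdot> g"
      if "u \<in> Hom (ind_cat C A) (Ind C A x) (Ind C A y)"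
        "v \<in> Hom (ind_cat C A) (Ind C A x) (Ind C A y)" for u v
      using ind.arr_comp_add_left[OF g arr_hom[OF that(1)] arr_hom[OF that(2)]] by simp
    show "(c *s u) \<cdot> g = c *s (u \<cdot> g)"
      if "u \<in> Hom (ind_cat C A) (Ind C A x) (Ind C A y)" for c u
      using ind.arr_comp_scale_left[OF g arr_hom[OF that]] by simp
    show "(\<lambda>u. u \<cdot> g) ` hom_degree C A L emb x y j = hom_degree C A L emb y y (j + - i)" for j
    proof (intro equalityI subsetI)
      fix u assume u: "u \<in> hom_degree C A L emb y y (j + - i)"
      then have "u \<cdot> f \<in> hom_degree C A L emb x y j"
        using hom_degree_comp[OF x y y fi u] by simp
      moreover have "u = (u \<cdot> f) \<cdot> g" using ufg[OF arr_deg[OF u y y]] by simp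
      ultimately show "u \<in> (\<lambda>u. u \<cdot> g) ` hom_degree C A L emb x y j" by blast
    next
      fix u assume "u \<in> (\<lambda>u. u \<cdot> g) ` hom_degree C A L emb x y j"
      then show "u \<in> hom_degree C A L emb y y (j + - i)"
        using hom_degree_comp[OF y x y gi] by (auto simp: add.commute)
    qed
  qed
  ultimately show ?thesis by blast
qed

end


theorem theorem4p6:
  fixes scale :: "'k::alg_closed_field \<Rightarrow> 'm::ab_group_add \<Rightarrow> 'm"
    and C :: "('o, 'm) monoidal_category"
    and L :: "'g::{ab_group_add, finite} \<Rightarrow> 'o"
    and lam :: "'g \<Rightarrow> 'g \<Rightarrow> 'm"
    and \<psi> :: "'g \<Rightarrow> 'g \<Rightarrow> 'g \<Rightarrow> 'k"
    and \<omega> :: "'g \<Rightarrow> 'g \<Rightarrow> 'k"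
    and A :: "('o, 'm) algebra"
    and emb prj :: "'g \<Rightarrow> 'm"
    and x y :: 'o
  assumes "CHAR('k) = 0 \<or> coprime CHAR('k) (card (UNIV :: 'g set))"
    and "abelian_monoidal_category scale C"
    and "simple_object C \<one>\<^bsub>C\<^esub>"
    and "bij_betw (\<lambda>c. scale c (Ident C \<one>\<^bsub>C\<^esub>)) UNIV (Hom C \<one>\<^bsub>C\<^esub> \<one>\<^bsub>C\<^esub>)"
    and "twisted_group_algebra scale C L lam \<psi> \<omega> A emb prj"
    and "x \<in> Obj C" and "quotient_simple (ind_cat C A) (Ind C A x)"
    and "y \<in> Obj C" and "quotient_simple (ind_cat C A) (Ind C A y)"
  shows "(Hom (ind_cat C A) (Ind C A x) (Ind C A y) = {0} \<or>
          (\<exists>d. graded_isomorphic_by scale d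
                 (Hom (ind_cat C A) (Ind C A x) (Ind C A y)) (hom_degree C A L emb x y)
                 (Hom (ind_cat C A) (Ind C A x) (Ind C A x)) (hom_degree C A L emb x x) \<and>
               graded_isomorphic_by scale d
                 (Hom (ind_cat C A) (Ind C A x) (Ind C A y)) (hom_degree C A L emb x y)
                 (Hom (ind_cat C A) (Ind C A y) (Ind C A y)) (hom_degree C A L emb y y)))
       \<and> (\<forall>i. \<forall>f \<in> hom_degree C A L emb x y i. f \<noteq> 0 \<longrightarrow>
            is_iso (ind_cat C A) (Ind C A x) (Ind C A y) f)"
proof -
  interpret twisted_group_algebra scale C L lam \<psi> \<omega> A emb prj by fact
  show ?thesis
    using hom_zero_or_graded_isomorphic homogeneous_iso assms(6-9) by blast
qed

end
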